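(* Let $\mathfrak{g}$ be of type $A_{n-1}$, $B_n$, $C_n$, $D_n$ or $G_2$, of rank $r$, with positive roots $R^+$ and set of simple roots $\Pi=\{\alpha_1,\dots,\alpha_r\}$. Let $\mathcal{T}(\infty)$ be the set of marginally large tableaux realizing $B(\infty)$, with the bijection $\Xi$ to multisegments, the graph structure $\mathbb{B}(\infty)$ and the set of source vertices $\mathcal{ST}(\infty)$. (1) For $T\in\mathcal{T}(\infty)$ with $\Xi(T)=\sum_{\alpha\in R^+}m_\alpha\,\alpha$, we have $T\in\mathcal{ST}(\infty)$ if and only if $m_{\alpha_i}=0$ for all $i=1,\dots,r$, i.e. $\Xi(T)=\sum_{\alpha\in R^+\setminus\Pi}m_\alpha\,\alpha$. (2) Each connected component of the graph $\mathbb{B}(\infty)$ contains a unique source vertex $S$; the component is then denoted $\mathbb{B}(S)$. (3) For any $S\in\mathcal{ST}(\infty)$, the vertices of $\mathbb{B}(S)$ have pairwise different weights, and $$\sum_{T\in\mathbb{B}(S)}t^{|T|}e^{\mathrm{wt}(T)}=\frac{t^{|S|}e^{\mathrm{wt}(S)}}{\prod_{\alpha\in\Pi}(1-te^{-\alpha})}.$$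
   Context: A multisegment is a finite multiset of positive roots, written as a formal sum $\mathfrak{m}=\sum_{\alpha\in R^+}m_\alpha\,\alpha$ with $m_\alpha\in\mathbb{Z}_{\ge0}$ the multiplicity of $\alpha$; let $\mathfrak{M}$ be the set of multisegments (formal sums, so distinct multisets are distinct elements of $\mathfrak M$). The crystal $B(\infty)$ of $\mathfrak{g}$ is realized (Hong-Lee) on the set $\mathcal{T}(\infty)$ of marginally large $\mathfrak{g}$-tableaux: these are $\mathfrak{g}$-tableaux with $d$ rows ($d=n$ in types $B_n,C_n$; $d=n-1$ in types $A_{n-1},D_n$; $d=2$ in type $G_2$) such that, for $i=1,\dots,d-1$, the number of boxes containing $i$ in row $i$ is $1$ plus the number of boxes in row $i+1$. There is a known bijection (Lee-Salisbury) $\Xi:\mathcal{T}(\infty)\to\mathfrak{M}$, compatible with weights: $\mathrm{wt}(T)=-\sum_{\alpha}m_\alpha\alpha$ if $\Xi(T)=\sum_\alpha m_\alpha\,\alpha$. For example, in type $A_{n-1}$, $m_{\varepsilon_i-\varepsilon_j}$ ($i<j$) is the number of letters $j$ in row $i$ of $T$. For $T\in\mathcal{T}(\infty)$ with $\Xi(T)=\sum_\alpha m_\alpha\,\alpha$, put $|T|=\sum_{\alpha\in R^+}m_\alpha$. For $i=1,\dots,r$, $\mathrm{F}_i(T)$ is the unique marginally large tableau $T'$ with $\Xi(T')=\Xi(T)+\alpha_i$. Define $\mathrm{E}_i(T_1)=T_2$ if there is $T_2\in\mathcal{T}(\infty)$ with $\mathrm{F}_i(T_2)=T_1$, and $\mathrm{E}_i(T_1)=0$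 otherwise. The colored directed graph $\mathbb{B}(\infty)$ has vertex set $\mathcal{T}(\infty)$ and an edge $T\overset{i}{\dashrightarrow}T'$ if and only if $T'=\mathrm{F}_i(T)$. A source vertex is a $T$ with $\mathrm{E}_i(T)=0$ for all $i=1,\dots,r$; $\mathcal{ST}(\infty)$ is the set of source vertices. Connected components are taken in the underlying undirected graph. *)

theory Defs
  imports
    "HOL-Library.Multiset"
    "HOL-Library.Poly_Mapping"
    "HOL-Computational_Algebra.Formal_Power_Series"
    "HOL-Analysis.Infinite_Sum"
begin

section \<open>Types, weights and roots\<close>

text \<open>\<open>TypeA n\<close> is the type $A_{n-1}$, of rank $n - 1$; \<open>TypeB n\<close>, \<open>TypeC n\<close>,
  \<open>TypeD n\<close> are $B_n$, $C_n$, $D_n$, of rank $n$.\<close>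

datatype lie_type = TypeA nat | TypeB nat | TypeC nat | TypeD nat | TypeG2

fun valid_type :: "lie_type \<Rightarrow> bool" where
  "valid_type (TypeA n) \<longleftrightarrow> 2 \<le> n"
| "valid_type (TypeB n) \<longleftrightarrow> 2 \<le> n"
| "valid_type (TypeC n) \<longleftrightarrow> 2 \<le> n"
| "valid_type (TypeD n) \<longleftrightarrow> 3 \<le> n"
| "valid_type TypeG2 \<longleftrightarrow> True"

fun lie_rank :: "lie_type \<Rightarrow> nat" where
  "lie_rank (TypeA n) = n - 1"
| "lie_rank (TypeB n) = n"
| "lie_rank (TypeC n) = n"
| "lie_rank (TypeD n) = n"
| "lie_rank TypeG2 = 2"

text \<open>Weights are integral combinations of the orthonormal vectors $\varepsilon_1, \varepsilon_2, \dots$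
  of the usual (Bourbaki) realizations.\<close>

type_synonym weight = "nat \<Rightarrow>\<^sub>0 int"

definition eps :: "nat \<Rightarrow> weight" where
  "eps i = Poly_Mapping.single i 1"

text \<open>The element $a \alpha_1 + b \alpha_2$ of the root lattice of $G_2$, where
  $\alpha_1 = \varepsilon_1 - \varepsilon_2$ is the short and
  $\alpha_2 = -2\varepsilon_1 + \varepsilon_2 + \varepsilon_3$ the long simple root.\<close>

definition g2_root :: "int \<Rightarrow> int \<Rightarrow> weight" where
  "g2_root a b = Poly_Mapping.single 1 (a - 2 * b) + Poly_Mapping.single 2 (b - a)
                 + Poly_Mapping.single 3 b"

fun pos_roots :: "lie_type \<Rightarrow> weight set" where
  "pos_roots (TypeA n) = {eps i - eps j | i j. 1 \<le> i \<and> i < j \<and> j \<le> n}"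
| "pos_roots (TypeB n) = {eps i - eps j | i j. 1 \<le> i \<and> i < j \<and> j \<le> n}
     \<union> {eps i + eps j | i j. 1 \<le> i \<and> i < j \<and> j \<le> n} \<union> {eps i | i. 1 \<le> i \<and> i \<le> n}"
| "pos_roots (TypeC n) = {eps i - eps j | i j. 1 \<le> i \<and> i < j \<and> j \<le> n}
     \<union> {eps i + eps j | i j. 1 \<le> i \<and> i < j \<and> j \<le> n} \<union> {eps i + eps i | i. 1 \<le> i \<and> i \<le> n}"
| "pos_roots (TypeD n) = {eps i - eps j | i j. 1 \<le> i \<and> i < j \<and> j \<le> n}
     \<union> {eps i + eps j | i j. 1 \<le> i \<and> i < j \<and> j \<le> n}"
| "pos_roots TypeG2 = {g2_root 1 0, g2_root 0 1, g2_root 1 1, g2_root 2 1, g2_root 3 1, g2_root 3 2}"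

fun simple_root :: "lie_type \<Rightarrow> nat \<Rightarrow> weight" where
  "simple_root (TypeA n) i = eps i - eps (i + 1)"
| "simple_root (TypeB n) i = (if i = n then eps n else eps i - eps (i + 1))"
| "simple_root (TypeC n) i = (if i = n then eps n + eps n else eps i - eps (i + 1))"
| "simple_root (TypeD n) i = (if i = n then eps (n - 1) + eps n else eps i - eps (i + 1))"
| "simple_root TypeG2 i = (if i = 1 then g2_root 1 0 else g2_root 0 1)"

definition simple_roots :: "lie_type \<Rightarrow> weight set" where
  "simple_roots X = simple_root X ` {1..lie_rank X}"

definition multisegments :: "lie_type \<Rightarrow> weight multiset set" where
  "multisegments X = {M. set_mset M \<subseteq> pos_roots X}"


section \<open>Marginally large tableaux\<close>

text \<open>\<open>Bar j\<close> is the letter $\overline{j}$ and \<open>Zero\<close> the letter $0$ of types $B_n$ and $G_2$.\<close>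

datatype letter = Pos nat | Zero | Bar nat

text \<open>$1 < 2 < \dots < 0 < \dots < \overline{2} < \overline{1}$, except that $n$ and $\overline{n}$ are
  incomparable in type $D_n$.\<close>

fun letter_less :: "lie_type \<Rightarrow> letter \<Rightarrow> letter \<Rightarrow> bool" where
  "letter_less X (Pos i) (Pos j) \<longleftrightarrow> i < j"
| "letter_less X (Pos i) Zero \<longleftrightarrow> True"
| "letter_less X (Pos i) (Bar j) \<longleftrightarrow> \<not> (X = TypeD i \<and> i = j)"
| "letter_less X Zero (Bar j) \<longleftrightarrow> True"
| "letter_less X (Bar i) (Bar j) \<longleftrightarrow> j < i"
| "letter_less X _ _ \<longleftrightarrow> False"

text \<open>Rows increase weakly, but the letter $0$ may not be repeated. In type $D_n$, a row sorted
  by this relation does not contain both $n$ and $\overline{n}$.\<close>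

definition row_le :: "lie_type \<Rightarrow> letter \<Rightarrow> letter \<Rightarrow> bool" where
  "row_le X a b \<longleftrightarrow> letter_less X a b \<or> (a = b \<and> a \<noteq> Zero)"

fun num_rows :: "lie_type \<Rightarrow> nat" where
  "num_rows (TypeA n) = n - 1"
| "num_rows (TypeB n) = n"
| "num_rows (TypeC n) = n"
| "num_rows (TypeD n) = n - 1"
| "num_rows TypeG2 = 2"

fun row_letters :: "lie_type \<Rightarrow> nat \<Rightarrow> letter set" where
  "row_letters (TypeA n) i = Pos ` {i..n}"
| "row_letters (TypeB n) i = Pos ` {i..n} \<union> {Zero} \<union> Bar ` {i..n}"
| "row_letters (TypeC n) i = Pos ` {i..n} \<union> Bar ` {i..n}"
| "row_letters (TypeD n) i = Pos ` {i..n} \<union> Bar ` {i..n}"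
| "row_letters TypeG2 i =
     (if i = 1 then Pos ` {1..3} \<union> {Zero} \<union> Bar ` {1..3} else {Pos 2, Pos 3})"

text \<open>A tableau is the list of its rows, from top to bottom. Rows are numbered from 1, and all
  rows below the last one are empty.\<close>

type_synonym tableau = "letter list list"

definition trow :: "tableau \<Rightarrow> nat \<Rightarrow> letter list" where
  "trow T i = (if 1 \<le> i \<and> i \<le> length T then T ! (i - 1) else [])"

text \<open>The explicit description by Hong and Lee of the marginally large tableaux: for large
  tableaux, the conditions on \<open>\<gg>\<close>-tableaux (Kashiwara-Nakashima, Kang-Misra) amount to
  semistandardness together with the restriction of row \<open>i\<close> to \<open>row_letters X i\<close>.\<close>

definition is_tableau :: "lie_type \<Rightarrow> tableau \<Rightarrow> bool" where
  "is_tableau X T \<longleftrightarrow> length T = num_rows X \<and>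
     (\<forall>i\<in>{1..num_rows X}.
        set (trow T i) \<subseteq> row_letters X i \<and>
        sorted_wrt (row_le X) (trow T i) \<and>
        length (trow T (i + 1)) \<le> length (trow T i) \<and>
        (\<forall>k < length (trow T (i + 1)). letter_less X (trow T i ! k) (trow T (i + 1) ! k)))"

text \<open>For the last row \<open>d\<close> the condition says that it contains exactly one letter \<open>d\<close>.\<close>

definition marginally_large :: "lie_type \<Rightarrow> tableau \<Rightarrow> bool" where
  "marginally_large X T \<longleftrightarrow>
     (\<forall>i\<in>{1..num_rows X}. count_list (trow T i) (Pos i) = 1 + length (trow T (i + 1)))"

definition T_inf :: "lie_type \<Rightarrow> tableau set" where
  "T_inf X = {T. is_tableau X T \<and> marginally_large X T}"

definition index_wt :: "lie_type \<Rightarrow> nat \<Rightarrow> weight" where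
  "index_wt X i =
     (if X = TypeG2
      then (if i = 1 then g2_root 2 1 else if i = 2 then g2_root 1 1 else g2_root 1 0)
      else eps i)"

fun letter_wt :: "lie_type \<Rightarrow> letter \<Rightarrow> weight" where
  "letter_wt X (Pos i) = index_wt X i"
| "letter_wt X Zero = 0"
| "letter_wt X (Bar i) = - index_wt X i"

text \<open>The weight of \<open>T\<close> in $B(\infty)$ is its weight as a \<open>\<gg>\<close>-tableau minus the highest weight of
  its shape, which is the weight of the tableau of that shape with all entries of row \<open>i\<close>
  equal to \<open>i\<close>.\<close>

definition wt :: "lie_type \<Rightarrow> tableau \<Rightarrow> weight" where
  "wt X T = (\<Sum>i = 1..num_rows X. \<Sum>b\<leftarrow>trow T i. letter_wt X b - letter_wt X (Pos i))"


section \<open>The Lee-Salisbury bijection\<close>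

text \<open>A letter \<open>b\<close> in row \<open>i\<close> contributes one or two positive roots, with sum the drop in weight
  from the letter \<open>i\<close> to \<open>b\<close>; the letter \<open>i\<close> itself contributes none.\<close>

fun box_mseg :: "lie_type \<Rightarrow> nat \<Rightarrow> letter \<Rightarrow> weight multiset" where
  "box_mseg TypeG2 i b =
     (if i = 1 then
        (case b of
           Pos j \<Rightarrow> (if j = 1 then {#} else if j = 2 then {#g2_root 1 0#} else {#g2_root 1 1#})
         | Zero \<Rightarrow> {#g2_root 2 1#}
         | Bar j \<Rightarrow> (if j = 1 then {#g2_root 2 1, g2_root 2 1#}
                    else if j = 2 then {#g2_root 3 2#} else {#g2_root 3 1#}))
      else if b = Pos 3 then {#g2_root 0 1#} else {#})"
| "box_mseg (TypeB n) i (Bar j) = (if j = i then {#eps i, eps i#} else {#eps i + eps j#})"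
| "box_mseg (TypeD n) i (Bar j) =
     (if j = i then {#eps i - eps n, eps i + eps n#} else {#eps i + eps j#})"
| "box_mseg X i (Bar j) = {#eps i + eps j#}"
| "box_mseg X i (Pos j) = (if j = i then {#} else {#eps i - eps j#})"
| "box_mseg X i Zero = {#eps i#}"

definition Xi :: "lie_type \<Rightarrow> tableau \<Rightarrow> weight multiset" where
  "Xi X T = (\<Sum>i = 1..num_rows X. \<Sum>b\<leftarrow>trow T i. box_mseg X i b)"

definition tsize :: "lie_type \<Rightarrow> tableau \<Rightarrow> nat" where
  "tsize X T = (\<Sum>\<alpha>\<in>pos_roots X. count (Xi X T) \<alpha>)"


section \<open>The graph on marginally large tableaux\<close>

definition F_op :: "lie_type \<Rightarrow> nat \<Rightarrow> tableau \<Rightarrow> tableau" where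
  "F_op X i T = (THE T'. T' \<in> T_inf X \<and> Xi X T' = Xi X T + {#simple_root X i#})"

text \<open>\<open>None\<close> plays the role of $0$.\<close>

definition E_op :: "lie_type \<Rightarrow> nat \<Rightarrow> tableau \<Rightarrow> tableau option" where
  "E_op X i T1 =
     (if \<exists>T2\<in>T_inf X. F_op X i T2 = T1 then Some (THE T2. T2 \<in> T_inf X \<and> F_op X i T2 = T1)
      else None)"

definition edges :: "lie_type \<Rightarrow> nat \<Rightarrow> (tableau \<times> tableau) set" where
  "edges X i = {(T, T'). T \<in> T_inf X \<and> T' \<in> T_inf X \<and> T' = F_op X i T}"

definition sources :: "lie_type \<Rightarrow> tableau set" where
  "sources X = {T \<in> T_inf X. \<forall>i\<in>{1..lie_rank X}. E_op X i T = None}"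

definition connected_rel :: "lie_type \<Rightarrow> (tableau \<times> tableau) set" where
  "connected_rel X =
     (let E = (\<Union>i\<in>{1..lie_rank X}. edges X i) in (E \<union> E\<inverse>)\<^sup>* \<inter> T_inf X \<times> T_inf X)"

definition components :: "lie_type \<Rightarrow> tableau set set" where
  "components X = T_inf X // connected_rel X"

definition component_of :: "lie_type \<Rightarrow> tableau \<Rightarrow> tableau set" where
  "component_of X S = connected_rel X `` {S}"


section \<open>Generating series\<close>

text \<open>Generating series are power series in $t$ over the group ring of the weight lattice (whose
  elements are the finitely supported functions \<open>weight \<Rightarrow>\<^sub>0 int\<close>, with convolution as product).
  Infinite sums converge in the \<open>t\<close>-adic topology, which is the library topology on \<open>fps\<close>.\<close>

type_synonym char_series = "(weight \<Rightarrow>\<^sub>0 int) fps"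

definition te :: "nat \<Rightarrow> weight \<Rightarrow> char_series" where
  "te k \<mu> = fps_X ^ k * fps_const (Poly_Mapping.single \<mu> 1)"

text \<open>The quotient by a series with constant coefficient 1, which is a unit. (The division of the
  class \<open>fps\<close> is not available, as the group ring is not of class \<open>inverse\<close>.)\<close>

definition series_quot :: "char_series \<Rightarrow> char_series \<Rightarrow> char_series" where
  "series_quot f g = f * fps_right_inverse g 1"

end

theory Submission
  imports Defs
begin

text \<open>
  Everything rests on the fact that \<open>Xi\<close> is a bijection from the marginally large tableaux to the
  multisegments. Marginal largeness fixes the number of letters \<open>i\<close> in row \<open>i\<close> once the rows below are
  known, and semistandardness between rows is then automatic. So a tableau amounts to a choice, for
  each row \<open>i\<close>, of a multiset of letters other than \<open>i\<close>, its \<open>content\<close> (\<open>T_inf_eqI\<close>,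
  \<open>tableau_with_contents\<close>). The only constraint on a content is that it can be sorted into a row:
  the letter \<open>0\<close> does not occur twice, and in type $D_n$ the letters $n$ and $\overline{n}$ do not occur
  together.

  Each letter of a content stands for one positive root, with one exception per row in types $B_n$ and
  $D_n$ and in the first row of $G_2$: the letter $\overline{i}$ of row \<open>i\<close> stands for the two roots of
  the excluded pair, \<open>0,0\<close> or $n,\overline{n}$. Conversely, a multiset of roots of the row is read as a
  content by replacing that pair by $\overline{i}$ as often as it occurs, and the exclusion of the pair
  makes this reading unique (\<open>bij_betw_pair_letter\<close>). Since the positive roots are the disjoint union
  of the roots of the rows, \<open>bij_betw_Xi\<close> follows.

  Through \<open>Xi\<close>, the operator \<open>F_op X i\<close> adds one copy of $\alpha_i$ to a multisegment, and it can be
  undone exactly when $\alpha_i$ occurs. Hence the part of a multisegment outside the simple roots is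
  constant along edges, and the multisegment consisting of that part alone is reachable by removing
  simple roots: components correspond to nonsimple parts, each contains one source \<open>S\<close>, and its
  vertices are \<open>Xi S + M\<close> for the multisets \<open>M\<close> of simple roots (\<open>connected_rel_iff\<close>,
  \<open>bij_betw_component\<close>). Weights separate these vertices because the simple roots are linearly
  independent (\<open>simple_roots_independent\<close>), and summing over all \<open>M\<close> gives the product of the
  geometric series of the simple roots (\<open>prod_mult_mset_series\<close>).\<close>

section \<open>Multisets in which some letters stand for pairs\<close>

lemma bij_betw_image_mset:
  assumes "inj_on f L"
  shows "bij_betw (image_mset f) {N. set_mset N \<subseteq> L} {M. set_mset M \<subseteq> f ` L}"
proof (rule bij_betw_byWitness[where f' = "image_mset (inv_into L f)"])
  show "\<forall>N\<in>{N. set_mset N \<subseteq> L}. image_mset (inv_into L f) (image_mset f N) = N"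
    using assms by (auto simp: multiset.map_comp subset_iff intro!: multiset.map_ident_strong)
  show "\<forall>M\<in>{M. set_mset M \<subseteq> f ` L}. image_mset f (image_mset (inv_into L f) M) = M"
    by (auto simp: multiset.map_comp subset_iff f_inv_into_f intro!: multiset.map_ident_strong)
qed (auto simp: inv_into_into subset_iff)

text \<open>The letter \<open>c\<close> is an abbreviation of the pair \<open>p, q\<close>. A multiset over \<open>L\<close> has many spellings with
  \<open>c\<close>, but only one that leaves no pair \<open>p, q\<close> unabbreviated. The case \<open>p = q\<close> is included: then
  \<open>{#p, q#} \<subseteq># N\<close> says that \<open>p\<close> occurs at least twice.\<close>

lemma bij_betw_pair_letter:
  fixes box :: "'a \<Rightarrow> 'b multiset"
  assumes inj: "inj_on f L" and "c \<notin> L" "p \<in> L" "q \<in> L"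
    and box: "\<And>b. b \<in> L \<Longrightarrow> box b = {#f b#}" "box c = {#f p, f q#}"
  shows "bij_betw (\<lambda>N. \<Sum>b\<in>#N. box b)
           {N. set_mset N \<subseteq> insert c L \<and> \<not> {#p, q#} \<subseteq># N} {M. set_mset M \<subseteq> f ` L}"
proof -
  let ?A = "{N. set_mset N \<subseteq> insert c L \<and> \<not> {#p, q#} \<subseteq># N}"
  \<comment> \<open>\<open>?s\<close> spells out every \<open>c\<close>; it remains to see that \<open>?s\<close> is a bijection onto the multisets over \<open>L\<close>.\<close>
  let ?s = "\<lambda>N. filter_mset (\<lambda>b. b \<noteq> c) N + repeat_mset (count N c) {#p, q#}"
  have split: "N = filter_mset (\<lambda>b. b \<noteq> c) N + replicate_mset (count N c) c" for N
    by (rule multiset_eqI) auto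
  have sum_L: "(\<Sum>b\<in>#N. box b) = image_mset f N" if "set_mset N \<subseteq> L" for N
    using that by (induction N) (auto simp: box)
  have sum_c: "(\<Sum>b\<in>#replicate_mset k c. box b) = image_mset f (repeat_mset k {#p, q#})" for k
    by (induction k) (auto simp: box)
  have sum_eq: "(\<Sum>b\<in>#N. box b) = image_mset f (?s N)" if "N \<in> ?A" for N
  proof -
    have "(\<Sum>b\<in>#N. box b)
        = (\<Sum>b\<in>#filter_mset (\<lambda>b. b \<noteq> c) N. box b) + (\<Sum>b\<in>#replicate_mset (count N c) c. box b)"
      by (subst split) (simp only: image_mset_union sum_mset.union)
    also have "\<dots> = image_mset f (?s N)"
      using that by (subst sum_L, auto simp only: sum_c image_mset_union) auto
    finally show ?thesis .
  qed
  have s_inj: "N = N'" if "N \<in> ?A" "N' \<in> ?A" "?s N = ?s N'" "count N c \<le> count N' c" for N N'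
  proof -
    define d where "d = count N' c - count N c"
    have *: "filter_mset (\<lambda>b. b \<noteq> c) N = filter_mset (\<lambda>b. b \<noteq> c) N' + repeat_mset d {#p, q#}"
    proof -
      have "repeat_mset (count N' c) {#p, q#} = repeat_mset (count N c) {#p, q#} + repeat_mset d {#p, q#}"
        by (rule multiset_eqI) (use that(4) in \<open>auto simp: d_def\<close>)
      with that(3) have "filter_mset (\<lambda>b. b \<noteq> c) N + repeat_mset (count N c) {#p, q#}
          = filter_mset (\<lambda>b. b \<noteq> c) N' + repeat_mset d {#p, q#} + repeat_mset (count N c) {#p, q#}"
        by (simp only: ac_simps)
      then show ?thesis by (rule add_right_imp_eq)
    qed
    \<comment> \<open>A surplus of \<open>c\<close> in \<open>N'\<close> would have to be matched by unabbreviated pairs in \<open>N\<close>.\<close>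
    have "d = 0"
    proof (rule ccontr)
      assume "d \<noteq> 0"
      then have "{#p, q#} \<subseteq># repeat_mset d {#p, q#}"
        by (intro mset_subset_eqI) (simp only: count_repeat_mset, simp)
      also have "\<dots> \<subseteq># filter_mset (\<lambda>b. b \<noteq> c) N"
        unfolding * by (rule mset_subset_eq_add_right)
      also have "\<dots> \<subseteq># N" by simp
      finally show False using that(1) by simp
    qed
    with * that(4) have "filter_mset (\<lambda>b. b \<noteq> c) N = filter_mset (\<lambda>b. b \<noteq> c) N'" "count N c = count N' c"
      by (auto simp: d_def)
    then show ?thesis using split by metis
  qed
  \<comment> \<open>Abbreviate pairs one at a time until none is left.\<close>
  have s_surj: "\<exists>N\<in>?A. ?s N = M" if "set_mset M \<subseteq> L" for M
    using that
  proof (induction "size M" arbitrary: M rule: less_induct)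
    case less
    show ?case
    proof (cases "{#p, q#} \<subseteq># M")
      case False
      have "filter_mset (\<lambda>b. b \<noteq> c) M = M" "count M c = 0"
        using less.prems \<open>c \<notin> L\<close> by (auto simp: filter_mset_eq_conv count_eq_zero_iff)
      then have "?s M = M" by simp
      then show ?thesis using False less.prems by blast
    next
      case True
      then obtain M' where M: "M = M' + {#p, q#}" by (metis subset_mset.add_diff_inverse add.commute)
      have "\<exists>N\<in>?A. ?s N = M'" by (rule less.hyps) (use less.prems M in auto)
      then obtain N where N: "N \<in> ?A" "?s N = M'" by blast
      have "{#p, q#} - {#c#} = {#p, q#}"
        using \<open>c \<notin> L\<close> \<open>p \<in> L\<close> \<open>q \<in> L\<close> by (intro diff_single_trivial) auto
      then have "\<not> {#p, q#} \<subseteq># N + {#c#}"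
        unfolding subset_eq_diff_conv[symmetric] using N(1) by simp
      then have "add_mset c N \<in> ?A" using N(1) by simp
      moreover have "?s (add_mset c N) = M" using N(2) by (auto simp: M)
      ultimately show ?thesis by blast
    qed
  qed
  have s_L: "set_mset (?s N) \<subseteq> L" if "N \<in> ?A" for N
    using that \<open>p \<in> L\<close> \<open>q \<in> L\<close> by auto
  have "bij_betw ?s ?A {M. set_mset M \<subseteq> L}"
  proof (rule bij_betw_imageI)
    show "inj_on ?s ?A"
    proof (rule inj_onI)
      fix N N' assume "N \<in> ?A" "N' \<in> ?A" "?s N = ?s N'"
      then show "N = N'"
        using s_inj[of N N'] s_inj[of N' N] by (cases "count N c \<le> count N' c") simp_all
    qed
    show "?s ` ?A = {M. set_mset M \<subseteq> L}"
    proof (intro equalityI subsetI)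
      fix M assume "M \<in> {M. set_mset M \<subseteq> L}"
      then show "M \<in> ?s ` ?A" using s_surj[of M] by blast
    qed (use s_L in blast)
  qed
  from bij_betw_trans[OF this bij_betw_image_mset[OF inj]]
  have "bij_betw (image_mset f \<circ> ?s) ?A {M. set_mset M \<subseteq> f ` L}" .
  then show ?thesis by (rule bij_betw_cong[THEN iffD1, rotated]) (simp only: sum_eq o_apply)
qed

section \<open>Rows and the multisets of their letters\<close>

text \<open>A linear extension of the order of the letters that is the same for all types: unbarred letters lie
  below 0 and barred letters above, in reverse. It makes sorting by a linear order available in type
  $D_n$, too, where it puts the incomparable $n$ below $\overline{n}$.\<close>

fun letter_key :: "letter \<Rightarrow> real" where
  "letter_key (Pos i) = - 1 / (real i + 1)"
| "letter_key Zero = 0"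
| "letter_key (Bar i) = 1 / (real i + 1)"

lemma inj_letter_key: "inj letter_key"
proof (rule injI)
  fix a b
  \<comment> \<open>The signs of the keys tell unbarred letters, \<open>0\<close> and barred letters apart.\<close>
  have pos: "0 < 1 / (real i + 1)" for i by simp
  show "letter_key a = letter_key b \<Longrightarrow> a = b"
    using pos[of "case a of Pos i \<Rightarrow> i | Bar i \<Rightarrow> i | _ \<Rightarrow> 0"]
      pos[of "case b of Pos i \<Rightarrow> i | Bar i \<Rightarrow> i | _ \<Rightarrow> 0"]
    by (cases a; cases b; simp add: field_simps)
qed

lemma letter_less_imp_key: "letter_less X a b \<Longrightarrow> letter_key a < letter_key b"
  by (cases "(X, a, b)" rule: letter_less.cases)
     (auto simp: frac_less2 intro: less_trans[of _ 0])

text \<open>The pairs are taken with multiplicity: \<open>a = b\<close> is considered only for a letter that occurs twice,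
  and this is how a repeated \<open>0\<close> is detected.\<close>

definition comparable :: "lie_type \<Rightarrow> letter multiset \<Rightarrow> bool" where
  "comparable X N \<longleftrightarrow> (\<forall>a b. {#a, b#} \<subseteq># N \<longrightarrow> row_le X a b \<or> row_le X b a)"

lemma incomparable_iff:
  "\<not> row_le X a b \<and> \<not> row_le X b a \<longleftrightarrow>
     a = Zero \<and> b = Zero \<or> (\<exists>n. X = TypeD n \<and> {a, b} = {Pos n, Bar n})"
  by (cases a; cases b) (auto simp: row_le_def doubleton_eq_iff)

lemma comparable_iff:
  "comparable X N \<longleftrightarrow> \<not> {#Zero, Zero#} \<subseteq># N \<and> (\<forall>n. X = TypeD n \<longrightarrow> \<not> {#Pos n, Bar n#} \<subseteq># N)"
proof -
  have "comparable X N \<longleftrightarrow>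
      \<not> (\<exists>a b. {#a, b#} \<subseteq># N \<and> (a = Zero \<and> b = Zero \<or> (\<exists>n. X = TypeD n \<and> {a, b} = {Pos n, Bar n})))"
    unfolding comparable_def incomparable_iff[symmetric] by blast
  also have "\<dots> \<longleftrightarrow> \<not> {#Zero, Zero#} \<subseteq># N \<and> (\<forall>n. X = TypeD n \<longrightarrow> \<not> {#Pos n, Bar n#} \<subseteq># N)"
    by (auto simp: doubleton_eq_iff add_mset_commute[of "Bar _"])
  finally show ?thesis .
qed

lemma sorted_row_key: "sorted_wrt (row_le X) xs \<Longrightarrow> sorted (map letter_key xs)"
  unfolding sorted_map
  by (erule sorted_wrt_mono_rel[rotated]) (auto simp: row_le_def dest: letter_less_imp_key)

text \<open>Two rows with the same letters are both sorted with respect to the injective \<open>letter_key\<close>.\<close>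

lemma sorted_row_unique:
  assumes "sorted_wrt (row_le X) xs" "sorted_wrt (row_le X) ys" "mset xs = mset ys"
  shows "xs = ys"
  using sort_key_inj_key_eq[of ys xs letter_key] sort_key_inj_key_eq[of ys ys letter_key] assms
    sorted_row_key inj_letter_key by (metis inj_on_subset top_greatest)

lemma pair_subset_mset_nth:
  assumes "i < j" "j < length xs"
  shows "{#xs ! i, xs ! j#} \<subseteq># mset xs"
  using assms
proof (induction xs arbitrary: i j)
  case (Cons x xs)
  then show ?case
    by (cases i; cases j) (auto intro: subset_mset.order_trans[of _ "mset xs"])
qed simp

text \<open>Sorting by \<open>letter_key\<close> works: it extends the order of the letters, so a pair that is comparable
  is never put in the wrong order.\<close>

lemma comparable_imp_sorted_row:
  assumes "comparable X N"
  shows "\<exists>xs. mset xs = N \<and> sorted_wrt (row_le X) xs"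
proof -
  obtain ys where ys: "mset ys = N" using ex_mset by blast
  define xs where "xs = sort_key letter_key ys"
  have mset: "mset xs = N" by (simp add: xs_def ys)
  have "row_le X (xs ! i) (xs ! j)" if ij: "i < j" "j < length xs" for i j
  proof -
    have "letter_key (xs ! i) \<le> letter_key (xs ! j)"
      using sorted_nth_mono[of "map letter_key xs" i j] ij by (simp add: xs_def)
    then have "\<not> letter_less X (xs ! j) (xs ! i)" using letter_less_imp_key by fastforce
    moreover have "row_le X (xs ! i) (xs ! j) \<or> row_le X (xs ! j) (xs ! i)"
      using assms pair_subset_mset_nth[OF ij] by (auto simp: mset comparable_def)
    ultimately show ?thesis by (auto simp: row_le_def)
  qed
  with mset show ?thesis by (auto simp: sorted_wrt_iff_nth_less)
qed

lemma sorted_row_comparable: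
  assumes "sorted_wrt (row_le X) xs"
  shows "comparable X (mset xs)"
  unfolding comparable_def using assms
proof (induction xs)
  case (Cons x xs)
  show ?case
  proof (intro allI impI)
    fix a b assume ab: "{#a, b#} \<subseteq># mset (x # xs)"
    show "row_le X a b \<or> row_le X b a"
    proof (cases "a = x \<or> b = x")
      case True
      then have "\<exists>c. c \<in> set xs \<and> {#a, b#} = {#x, c#}"
        using ab by (auto simp: add_mset_commute)
      then show ?thesis using Cons.prems by (auto simp: add_eq_conv_ex)
    next
      case False
      then have "{#a, b#} - {#x#} = {#a, b#}" by (intro diff_single_trivial) auto
      moreover have "{#a, b#} - {#x#} \<subseteq># mset xs" using ab by (simp only: subset_eq_diff_conv) simp
      ultimately have "{#a, b#} \<subseteq># mset xs" by simp
      then show ?thesis using Cons by simp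
    qed
  qed
qed simp

section \<open>Tableaux and the contents of their rows\<close>

text \<open>The letters \<open>i\<close> of row \<open>i\<close> are left out, as their number is determined by the row below.\<close>

definition content :: "tableau \<Rightarrow> nat \<Rightarrow> letter multiset" where
  "content T i = filter_mset (\<lambda>b. b \<noteq> Pos i) (mset (trow T i))"

definition row_contents :: "lie_type \<Rightarrow> nat \<Rightarrow> letter multiset set" where
  "row_contents X i = {N. set_mset N \<subseteq> row_letters X i - {Pos i} \<and> comparable X N}"

lemma Pos_in_row_letters: "i \<in> {1..num_rows X} \<Longrightarrow> Pos i \<in> row_letters X i"
  by (cases X) (auto simp: image_iff)

lemma Pos_less_row_letters:
  assumes "i \<in> {1..num_rows X}" "b \<in> row_letters X i" "b \<noteq> Pos i"
  shows "letter_less X (Pos i) b"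
  using assms by (cases X) (auto split: if_splits)

lemma Pos_less_next_row_letters:
  assumes "Suc i \<in> {1..num_rows X}" "b \<in> row_letters X (Suc i)" "1 \<le> i"
  shows "letter_less X (Pos i) b"
  using assms by (cases X) (auto split: if_splits)

lemma trow_mset:
  assumes "T \<in> T_inf X" "i \<in> {1..num_rows X}"
  shows "mset (trow T i) = content T i + replicate_mset (Suc (length (trow T (Suc i)))) (Pos i)"
proof -
  have "count (mset (trow T i)) (Pos i) = Suc (length (trow T (Suc i)))"
    using assms by (simp add: T_inf_def marginally_large_def count_mset)
  then show ?thesis
    by (intro multiset_eqI) (auto simp: content_def)
qed

lemma content_in_row_contents:
  assumes "T \<in> T_inf X" "i \<in> {1..num_rows X}"
  shows "content T i \<in> row_contents X i"
proof -
  have "set (trow T i) \<subseteq> row_letters X i" "sorted_wrt (row_le X) (trow T i)"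
    using assms by (auto simp: T_inf_def is_tableau_def)
  moreover from this have "comparable X (mset (trow T i))" by (simp add: sorted_row_comparable)
  ultimately show ?thesis
    unfolding row_contents_def content_def comparable_def
    by (auto intro: subset_mset.order_trans[OF _ multiset_filter_subset])
qed

text \<open>Going up from the last row, the content of a row and the length of the row below determine the
  letters of the row, and thereby the row.\<close>

lemma T_inf_eqI:
  assumes T: "T \<in> T_inf X" "T' \<in> T_inf X"
    and eq: "\<And>i. i \<in> {1..num_rows X} \<Longrightarrow> content T i = content T' i"
  shows "T = T'"
proof -
  define d where "d = num_rows X"
  have len: "length T = d" "length T' = d"
    using T by (auto simp: T_inf_def is_tableau_def d_def)
  have "1 \<le> i \<Longrightarrow> trow T i = trow T' i" if "i \<le> Suc d" for i
    using that
  proof (induction rule: inc_induct)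
    case base
    then show ?case by (simp add: trow_def len)
  next
    case (step i)
    then have i: "i \<in> {1..num_rows X}" by (simp add: d_def)
    have "mset (trow T i) = mset (trow T' i)"
      using trow_mset[OF T(1) i] trow_mset[OF T(2) i] eq[OF i] step by simp
    then show ?case using i T
      by (intro sorted_row_unique[of X]) (auto simp: T_inf_def is_tableau_def)
  qed
  then have "T ! k = T' ! k" if "k < d" for k
    using that by (force simp: trow_def len dest: spec[of _ "Suc k"])
  then show ?thesis
    by (intro nth_equalityI) (simp_all only: len)
qed

text \<open>Put the sorted contents behind as many letters \<open>i\<close> as marginal largeness asks for. There is one
  more \<open>i\<close> in row \<open>i\<close> than there are boxes in the row below, so that all boxes of row \<open>i + 1\<close> lie
  below a letter \<open>i\<close>, and columns increase whatever the contents are.\<close>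

lemma tableau_with_contents:
  assumes "\<And>i. i \<in> {1..num_rows X} \<Longrightarrow> N i \<in> row_contents X i"
  shows "\<exists>T\<in>T_inf X. \<forall>i\<in>{1..num_rows X}. content T i = N i"
proof -
  define d where "d = num_rows X"
  have "\<forall>i\<in>{1..d}. \<exists>xs. mset xs = N i \<and> sorted_wrt (row_le X) xs"
    using assms comparable_imp_sorted_row by (auto simp: row_contents_def d_def)
  then obtain rest where rest:
    "\<And>i. i \<in> {1..d} \<Longrightarrow> mset (rest i) = N i" "\<And>i. i \<in> {1..d} \<Longrightarrow> sorted_wrt (row_le X) (rest i)"
    by metis
  \<comment> \<open>\<open>m i\<close> is the length of row \<open>i + 1\<close>: row \<open>i\<close> is longer than row \<open>i + 1\<close> by its content and one letter \<open>i\<close>.\<close>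
  define m where "m i = (\<Sum>j = Suc i..d. Suc (size (N j)))" for i
  define row where "row i = replicate (Suc (m i)) (Pos i) @ rest i" for i
  define T where "T = map row [1..<Suc d]"
  have trow: "trow T i = (if i \<in> {1..d} then row i else [])" for i
    by (auto simp: trow_def T_def nth_append simp del: upt_Suc)
  have len: "length (trow T (Suc i)) = m i" if "i \<in> {1..d}" for i
  proof (cases "i < d")
    case True
    then have "m i = Suc (size (N (Suc i))) + m (Suc i)"
      unfolding m_def by (subst sum.atLeast_Suc_atMost) auto
    with True show ?thesis by (simp add: trow row_def flip: size_mset) (simp add: rest)
  next
    case False
    with that show ?thesis by (simp add: trow m_def)
  qed
  have rest_letters: "b \<in> row_letters X i" "b \<noteq> Pos i" if "b \<in> set (rest i)" "i \<in> {1..d}" for b i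
  proof -
    have "b \<in># N i" using that by (simp flip: rest(1))
    then show "b \<in> row_letters X i" "b \<noteq> Pos i"
      using assms[of i] that by (auto simp: row_contents_def d_def)
  qed
  have row_letters: "set (row i) \<subseteq> row_letters X i" if "i \<in> {1..d}" for i
    using that rest_letters[OF _ that] Pos_in_row_letters[of i X] by (auto simp: row_def d_def)
  have "is_tableau X T"
    unfolding is_tableau_def
  proof (intro conjI ballI allI impI)
    show "length T = num_rows X" by (simp add: T_def d_def)
    fix i assume "i \<in> {1..num_rows X}"
    then have i: "i \<in> {1..d}" by (simp add: d_def)
    show "set (trow T i) \<subseteq> row_letters X i"
      using row_letters[OF i] i by (simp add: trow)
    have "row_le X (Pos i) b" if "b \<in> set (rest i)" for b
      using rest_letters[OF that i] Pos_less_row_letters i by (auto simp: row_le_def d_def)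
    moreover have "sorted_wrt (row_le X) (replicate k (Pos i))" for k
      by (induction k) (auto simp: row_le_def)
    ultimately show "sorted_wrt (row_le X) (trow T i)"
      using i rest(2)[OF i] by (auto simp: trow row_def sorted_wrt_append simp del: replicate_Suc)
    show "length (trow T (i + 1)) \<le> length (trow T i)"
      using i by (simp add: len) (simp add: trow row_def)
    fix k assume k: "k < length (trow T (i + 1))"
    then have "trow T i ! k = Pos i"
      using i by (simp add: len) (simp add: trow row_def nth_append del: replicate_Suc)
    moreover have "Suc i \<in> {1..d}" using k by (auto simp: trow split: if_splits)
    moreover from this have "trow T (i + 1) ! k \<in> row_letters X (Suc i)"
      using k row_letters[of "Suc i"] by (auto simp: trow)
    ultimately show "letter_less X (trow T i ! k) (trow T (i + 1) ! k)"
      using Pos_less_next_row_letters i by (simp add: d_def)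
  qed
  moreover have "count_list (trow T i) (Pos i) = 1 + length (trow T (i + 1))" if i: "i \<in> {1..d}" for i
  proof -
    have "count_list (rest i) (Pos i) = 0" using rest_letters(2)[OF _ i] by (auto simp: count_list_0_iff)
    then show ?thesis using i
      by (simp add: len) (simp add: trow row_def flip: count_mset)
  qed
  moreover have "content T i = N i" if i: "i \<in> {1..d}" for i
  proof -
    have "count (mset (rest i)) (Pos i) = 0"
      using rest_letters(2)[OF _ i] by (auto simp: count_eq_zero_iff)
    then have "content T i = mset (rest i)"
      using i by (intro multiset_eqI) (auto simp: content_def trow row_def)
    then show ?thesis by (simp only: rest(1)[OF i])
  qed
  ultimately show ?thesis
    by (intro bexI[of _ T]) (auto simp: T_inf_def marginally_large_def d_def)
qed

section \<open>The positive roots, row by row\<close>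

lemma lookup_eps [simp]: "Poly_Mapping.lookup (eps i) k = (if i = k then 1 else 0)"
  by (simp add: eps_def lookup_single when_def)

lemma lookup_g2_root:
  "Poly_Mapping.lookup (g2_root a b) k = (if k = 1 then a - 2 * b else if k = 2 then b - a else if k = 3 then b else 0)"
  by (simp add: g2_root_def lookup_add lookup_single when_def)

lemma g2_root_eq_iff [simp]: "g2_root a b = g2_root c d \<longleftrightarrow> a = c \<and> b = d"
proof
  assume "g2_root a b = g2_root c d"
  then have "Poly_Mapping.lookup (g2_root a b) k = Poly_Mapping.lookup (g2_root c d) k" for k by simp
  from this[of 1] this[of 3] show "a = c \<and> b = d" by (simp add: lookup_g2_root)
qed simp

lemma g2_root_arith [simp]:
  "g2_root a b + g2_root c d = g2_root (a + c) (b + d)"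
  "g2_root a b - g2_root c d = g2_root (a - c) (b - d)"
  "- g2_root a b = g2_root (- a) (- b)"
  by (rule poly_mapping_eqI; simp add: lookup_g2_root lookup_add lookup_minus)+

lemma zero_g2_root: "0 = g2_root 0 0"
  by (rule poly_mapping_eqI) (simp add: lookup_g2_root)

lemma g2_root_eq_0_iff [simp]: "g2_root a b = 0 \<longleftrightarrow> a = 0 \<and> b = 0"  "0 = g2_root a b \<longleftrightarrow> a = 0 \<and> b = 0"
  by (auto simp: zero_g2_root)

text \<open>The letters that contribute exactly one root to row \<open>i\<close>. Besides these and the letter \<open>i\<close>, row \<open>i\<close>
  admits at most the letter $\overline{i}$ that contributes two roots.\<close>

fun root_letters :: "lie_type \<Rightarrow> nat \<Rightarrow> letter set" where
  "root_letters (TypeA n) i = Pos ` {i<..n}"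
| "root_letters (TypeB n) i = Pos ` {i<..n} \<union> {Zero} \<union> Bar ` {i<..n}"
| "root_letters (TypeC n) i = Pos ` {i<..n} \<union> {Bar i} \<union> Bar ` {i<..n}"
| "root_letters (TypeD n) i = Pos ` {i<..n} \<union> Bar ` {i<..n}"
| "root_letters TypeG2 i = (if i = 1 then {Pos 2, Pos 3, Zero, Bar 3, Bar 2} else {Pos 3})"

text \<open>The drop in weight from \<open>i\<close> to \<open>b\<close>; for the letters in \<open>root_letters\<close> this is the root that
  \<open>b\<close> contributes. In this form injectivity reduces to the letters having different weights.\<close>

definition letter_root :: "lie_type \<Rightarrow> nat \<Rightarrow> letter \<Rightarrow> weight" where
  "letter_root X i b = letter_wt X (Pos i) - letter_wt X b"

definition row_roots :: "lie_type \<Rightarrow> nat \<Rightarrow> weight set" where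
  "row_roots X i = letter_root X i ` root_letters X i"

lemma eps_eq_iff [simp]: "eps i = eps j \<longleftrightarrow> i = j"
proof
  assume "eps i = eps j"
  from arg_cong[OF this, of "\<lambda>v. Poly_Mapping.lookup v i"] show "i = j" by (simp split: if_splits)
qed simp

lemma eps_neq_minus [simp]: "eps i \<noteq> - eps j" "- eps j \<noteq> eps i"
proof -
  show "eps i \<noteq> - eps j"
  proof
    assume "eps i = - eps j"
    from arg_cong[OF this, of "\<lambda>v. Poly_Mapping.lookup v i"] show False by (simp split: if_splits)
  qed
  then show "- eps j \<noteq> eps i" by metis
qed

lemma eps_neq_0 [simp]: "eps i \<noteq> 0" "0 \<noteq> eps i"
proof -
  show "eps i \<noteq> 0"
  proof
    assume "eps i = 0"
    from arg_cong[OF this, of "\<lambda>v. Poly_Mapping.lookup v i"] show False by simp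
  qed
  then show "0 \<noteq> eps i" by metis
qed

lemma inj_on_letter_wt: "inj_on (letter_wt X) (row_letters X i)"
proof (cases "X = TypeG2")
  case True
  have "{1..3} = {1, 2, 3::nat}" by auto
  with True show ?thesis
    by (auto simp: inj_on_def index_wt_def)
next
  case False
  have "letter_wt X a = letter_wt X b \<Longrightarrow> a = b" for a b
    using False by (cases a; cases b) (auto simp: index_wt_def)
  then show ?thesis by (auto intro: inj_onI)
qed

lemma root_letters_subset: "i \<in> {1..num_rows X} \<Longrightarrow> root_letters X i \<subseteq> row_letters X i"
  by (cases X) auto

lemma inj_on_letter_root:
  "i \<in> {1..num_rows X} \<Longrightarrow> inj_on (letter_root X i) (root_letters X i)"
  using inj_on_subset[OF inj_on_letter_wt root_letters_subset]
  by (auto simp: inj_on_def letter_root_def)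

lemma box_mseg_root_letter:
  assumes "i \<in> {1..num_rows X}" "b \<in> root_letters X i"
  shows "box_mseg X i b = {#letter_root X i b#}"
proof (cases X)
  case TypeG2
  have "{1..3} = {1, 2, 3::nat}" by auto
  with TypeG2 assms show ?thesis
    by (auto simp: letter_root_def index_wt_def split: if_splits)
qed (use assms in \<open>auto simp: letter_root_def index_wt_def\<close>)

text \<open>In types $A_{n-1}$ and $C_n$ and in the second row of $G_2$, letters and roots of a row
  match one to one. In the other cases $\overline{i}$ abbreviates the excluded pair: \<open>0,0\<close> for $B_n$ and
  $G_2$, as $2\varepsilon_i = \varepsilon_i + \varepsilon_i$ (with $2\alpha_1 + \alpha_2$ for $\varepsilon_i$ in $G_2$),
  and $n,\overline{n}$ for $D_n$, as
  $2\varepsilon_i = (\varepsilon_i - \varepsilon_n) + (\varepsilon_i + \varepsilon_n)$.\<close>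

lemma bij_betw_row_contents:
  assumes "i \<in> {1..num_rows X}"
  shows "bij_betw (\<lambda>N. \<Sum>b\<in>#N. box_mseg X i b) (row_contents X i) {M. set_mset M \<subseteq> row_roots X i}"
proof -
  note root = box_mseg_root_letter[OF assms]
  note inj = inj_on_letter_root[OF assms]
  have plain: ?thesis
    if "row_letters X i - {Pos i} = root_letters X i" "Zero \<notin> row_letters X i"
      "\<And>n. X = TypeD n \<Longrightarrow> False"
  proof -
    have "Zero \<notin># N" if "set_mset N \<subseteq> root_letters X i" for N
      using \<open>Zero \<notin> row_letters X i\<close> root_letters_subset[OF assms] that by blast
    then have "\<not> {#Zero, Zero#} \<subseteq># N" if "set_mset N \<subseteq> root_letters X i" for N
      using that by (auto dest: mset_subset_eqD[of _ _ Zero])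
    then have contents: "row_contents X i = {N. set_mset N \<subseteq> root_letters X i}"
      using that(3) unfolding row_contents_def that(1) comparable_iff by blast
    have "(\<Sum>b\<in>#N. box_mseg X i b) = image_mset (letter_root X i) N" if "set_mset N \<subseteq> root_letters X i" for N
      using that by (induction N) (auto simp: root)
    then show ?thesis
      unfolding contents row_roots_def
      by (intro bij_betw_cong[THEN iffD1, OF _ bij_betw_image_mset[OF inj]]) simp
  qed
  have pair: ?thesis
    if "row_letters X i - {Pos i} = insert c (root_letters X i)"
      "c \<notin> root_letters X i" "p \<in> root_letters X i" "q \<in> root_letters X i"
      "box_mseg X i c = {#letter_root X i p, letter_root X i q#}"
      "\<And>N. set_mset N \<subseteq> insert c (root_letters X i) \<Longrightarrow> comparable X N \<longleftrightarrow> \<not> {#p, q#} \<subseteq># N" for c p q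
  proof -
    have contents: "row_contents X i = {N. set_mset N \<subseteq> insert c (root_letters X i) \<and> \<not> {#p, q#} \<subseteq># N}"
      using that(6) unfolding row_contents_def that(1) by blast
    show ?thesis
      unfolding contents row_roots_def
      by (rule bij_betw_pair_letter[OF inj that(2-4) root that(5)])
  qed
  show ?thesis
  proof (cases X)
    case (TypeA n)
    show ?thesis by (rule plain) (use assms in \<open>auto simp: TypeA\<close>)
  next
    case (TypeB n)
    show ?thesis
      by (rule pair[of "Bar i" Zero Zero])
         (use assms in \<open>auto simp: TypeB comparable_iff letter_root_def index_wt_def\<close>)
  next
    case (TypeC n)
    show ?thesis by (rule plain) (use assms in \<open>auto simp: TypeC\<close>)
  next
    case (TypeD n)
    have "\<not> {#Zero, Zero#} \<subseteq># N" if "set_mset N \<subseteq> insert (Bar i) (root_letters X i)" for N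
      using that by (auto simp: TypeD dest!: mset_subset_eqD[of _ _ Zero])
    then show ?thesis
      by (intro pair[of "Bar i" "Pos n" "Bar n"])
         (use assms in \<open>auto simp: TypeD comparable_iff letter_root_def index_wt_def\<close>)
  next
    case TypeG2
    have "{1..3} = {1, 2, 3::nat}" by auto
    show ?thesis
    proof (cases "i = 1")
      case True
      show ?thesis
        by (rule pair[of "Bar 1" Zero Zero])
           (use True \<open>{1..3} = {1, 2, 3::nat}\<close> in \<open>auto simp: TypeG2 comparable_iff letter_root_def index_wt_def\<close>)
    next
      case False
      show ?thesis by (rule plain) (use assms False in \<open>auto simp: TypeG2\<close>)
    qed
  qed
qed

text \<open>The number \<open>m\<close> of rows is \<open>n - 1\<close> in types $A_{n-1}$ and $D_n$ and \<open>n\<close> in types $B_n$ and $C_n$; for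
  \<open>i = n\<close> there is no \<open>j\<close>.\<close>

lemma Union_image_greater:
  fixes m n :: nat
  assumes "n - 1 \<le> m" "m \<le> n"
  shows "(\<Union>i\<in>{1..m}. f i ` {i<..n}) = {f i j | i j. 1 \<le> i \<and> i < j \<and> j \<le> n}"
proof (intro equalityI subsetI)
  fix x assume "x \<in> {f i j | i j. 1 \<le> i \<and> i < j \<and> j \<le> n}"
  then obtain i j where "x = f i j" "1 \<le> i" "i < j" "j \<le> n" by blast
  moreover from this assms have "i \<in> {1..m}" by auto
  ultimately show "x \<in> (\<Union>i\<in>{1..m}. f i ` {i<..n})" by fastforce
qed (auto, blast)

lemma Union_image_singleton: "(\<Union>i\<in>{1..n::nat}. {f i}) = {f i | i. 1 \<le> i \<and> i \<le> n}"
  by auto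

lemma Union_row_roots: "(\<Union>i\<in>{1..num_rows X}. row_roots X i) = pos_roots X"
proof (cases X)
  case (TypeA n)
  have rows: "row_roots (TypeA n) i = (\<lambda>j. eps i - eps j) ` {i<..n}" for i
    by (simp add: row_roots_def letter_root_def index_wt_def image_image image_Un)
  show ?thesis
    by (simp only: TypeA rows UN_Un_distrib Union_image_greater Union_image_singleton
        num_rows.simps pos_roots.simps diff_le_self order_refl Un_ac)
next
  case (TypeB n)
  have rows: "row_roots (TypeB n) i = (\<lambda>j. eps i - eps j) ` {i<..n} \<union> (\<lambda>j. eps i + eps j) ` {i<..n} \<union> {eps i}" for i
    by (simp add: row_roots_def letter_root_def index_wt_def image_image image_Un)
  show ?thesis
    by (simp only: TypeB rows UN_Un_distrib Union_image_greater Union_image_singleton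
        num_rows.simps pos_roots.simps diff_le_self order_refl Un_ac)
next
  case (TypeC n)
  have rows: "row_roots (TypeC n) i = (\<lambda>j. eps i - eps j) ` {i<..n} \<union> (\<lambda>j. eps i + eps j) ` {i<..n} \<union> {eps i + eps i}" for i
    by (simp add: row_roots_def letter_root_def index_wt_def image_image image_Un)
  show ?thesis
    by (simp only: TypeC rows UN_Un_distrib Union_image_greater Union_image_singleton
        num_rows.simps pos_roots.simps diff_le_self order_refl Un_ac)
next
  case (TypeD n)
  have rows: "row_roots (TypeD n) i = (\<lambda>j. eps i - eps j) ` {i<..n} \<union> (\<lambda>j. eps i + eps j) ` {i<..n}" for i
    by (simp add: row_roots_def letter_root_def index_wt_def image_image image_Un)
  show ?thesis
    by (simp only: TypeD rows UN_Un_distrib Union_image_greater Union_image_singleton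
        num_rows.simps pos_roots.simps diff_le_self order_refl Un_ac)
next
  case TypeG2
  have "{1..3} = {1, 2, 3::nat}" "{1..2} = {1, 2::nat}" by auto
  then show ?thesis
    by (auto simp: TypeG2 row_roots_def letter_root_def index_wt_def)
qed

text \<open>The row of a root can be read off from its first nonzero coordinate.\<close>

lemma row_roots_leading_coeff:
  assumes "X \<noteq> TypeG2" "\<alpha> \<in> row_roots X i"
  shows "Poly_Mapping.lookup \<alpha> i \<noteq> 0 \<and> (\<forall>k<i. Poly_Mapping.lookup \<alpha> k = 0)"
proof -
  obtain b where b: "b \<in> root_letters X i" "\<alpha> = letter_root X i b"
    using assms by (auto simp: row_roots_def)
  have "\<alpha> = eps i - letter_wt X b"
    using assms(1) by (simp add: b letter_root_def index_wt_def)
  moreover have "letter_wt X b = 0 \<or> (\<exists>j>i. letter_wt X b = eps j \<or> letter_wt X b = - eps j) \<or> letter_wt X b = - eps i"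
    using assms(1) b(1) by (cases X) (auto simp: index_wt_def)
  ultimately show ?thesis
    by (auto simp: lookup_minus)
qed

lemma row_roots_disjoint:
  assumes "i \<in> {1..num_rows X}" "j \<in> {1..num_rows X}" "i \<noteq> j"
  shows "row_roots X i \<inter> row_roots X j = {}"
proof -
  have less: "row_roots X i \<inter> row_roots X j = {}"
    if "i \<in> {1..num_rows X}" "j \<in> {1..num_rows X}" "i < j" for i j
  proof (cases "X = TypeG2")
    case True
    have "{1..3} = {1, 2, 3::nat}" "i = 1" "j = 2" using that True by auto
    then show ?thesis
      by (auto simp: True row_roots_def letter_root_def index_wt_def)
  next
    case False
    then show ?thesis using row_roots_leading_coeff[of X] \<open>i < j\<close> by blast
  qed
  show ?thesis
    using less[of i j] less[of j i] assms
    by (cases i j rule: linorder_cases) (auto simp: Int_commute)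
qed

section \<open>The bijection between tableaux and multisegments\<close>

lemma box_mseg_Pos: "i \<in> {1..num_rows X} \<Longrightarrow> box_mseg X i (Pos i) = {#}"
  by (cases X) (auto simp: le_Suc_eq numeral_2_eq_2)

lemma Xi_content:
  assumes "T \<in> T_inf X"
  shows "Xi X T = (\<Sum>i = 1..num_rows X. \<Sum>b\<in>#content T i. box_mseg X i b)"
  unfolding Xi_def
proof (rule sum.cong[OF refl])
  fix i assume i: "i \<in> {1..num_rows X}"
  have "(\<Sum>b\<leftarrow>trow T i. box_mseg X i b) = (\<Sum>b\<in>#mset (trow T i). box_mseg X i b)"
    by (simp flip: sum_mset_sum_list)
  also have "\<dots> = (\<Sum>b\<in>#content T i. box_mseg X i b)"
    unfolding trow_mset[OF assms i] by (simp add: box_mseg_Pos[OF i])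
  finally show "(\<Sum>b\<leftarrow>trow T i. box_mseg X i b) = (\<Sum>b\<in>#content T i. box_mseg X i b)" .
qed

lemma filter_mset_sum: "filter_mset P (\<Sum>i\<in>I. f i) = (\<Sum>i\<in>I. filter_mset P (f i))"
  by (induction I rule: infinite_finite_induct) auto

lemma sum_filter_mset_disjoint:
  assumes "finite I" "\<And>i j. i \<in> I \<Longrightarrow> j \<in> I \<Longrightarrow> i \<noteq> j \<Longrightarrow> R i \<inter> R j = {}"
  shows "(\<Sum>i\<in>I. filter_mset (\<lambda>x. x \<in> R i) M) = filter_mset (\<lambda>x. x \<in> (\<Union>i\<in>I. R i)) M"
  using assms
proof (induction I rule: finite_induct)
  case (insert i I)
  have "x \<notin> R j" if "x \<in> R i" "j \<in> I" for x j
    using insert.prems[of i j] insert.hyps that by auto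
  moreover have "(\<Sum>i\<in>I. filter_mset (\<lambda>x. x \<in> R i) M) = filter_mset (\<lambda>x. x \<in> (\<Union>i\<in>I. R i)) M"
    using insert.prems by (intro insert.IH) auto
  ultimately show ?case using insert.hyps
    by (auto intro!: multiset_eqI)
qed simp

text \<open>The roots of row \<open>i\<close> in \<open>Xi X T\<close> are those contributed by row \<open>i\<close> of \<open>T\<close>, because the sets of roots
  of the rows are disjoint. So \<open>Xi\<close> is bijective because it is on the content of each row.\<close>

lemma bij_betw_Xi: "bij_betw (Xi X) (T_inf X) (multisegments X)"
proof -
  let ?I = "{1..num_rows X}"
  let ?box = "\<lambda>i N. \<Sum>b\<in>#N. box_mseg X i b"
  note bij = bij_betw_row_contents[where X = X]
  have row: "set_mset (?box i (content T i)) \<subseteq> row_roots X i" if "T \<in> T_inf X" "i \<in> ?I" for T i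
    using bij_betw_apply[OF bij[OF that(2)] content_in_row_contents[OF that]] by simp
  have part: "filter_mset (\<lambda>\<alpha>. \<alpha> \<in> row_roots X i) (Xi X T) = ?box i (content T i)"
    if T: "T \<in> T_inf X" and i: "i \<in> ?I" for T i
  proof -
    have keep: "filter_mset (\<lambda>\<alpha>. \<alpha> \<in> R) B = B" if "set_mset B \<subseteq> R" for R and B :: "weight multiset"
      using that by (auto simp: filter_mset_eq_conv)
    have "filter_mset (\<lambda>\<alpha>. \<alpha> \<in> row_roots X i) (?box j (content T j))
        = (if j = i then ?box i (content T i) else {#})" if "j \<in> ?I" for j
    proof (cases "j = i")
      case True
      then show ?thesis using keep[OF row[OF T i]] by simp
    next
      case False
      have "filter_mset (\<lambda>\<alpha>. \<alpha> \<in> row_roots X i) B = {#}" if "set_mset B \<subseteq> row_roots X j" for B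
        using that row_roots_disjoint[OF i \<open>j \<in> ?I\<close>] False by auto
      from this[OF row[OF T that]] False show ?thesis by simp
    qed
    then show ?thesis
      using i by (simp add: Xi_content[OF T] filter_mset_sum)
  qed
  show ?thesis
  proof (rule bij_betw_imageI)
    show "inj_on (Xi X) (T_inf X)"
    proof (rule inj_onI)
      fix T T' assume T: "T \<in> T_inf X" "T' \<in> T_inf X" and eq: "Xi X T = Xi X T'"
      show "T = T'"
      proof (rule T_inf_eqI[OF T])
        fix i assume i: "i \<in> ?I"
        have "?box i (content T i) = ?box i (content T' i)"
          using part[OF T(1) i] part[OF T(2) i] eq by simp
        then show "content T i = content T' i"
          using bij_betw_imp_inj_on[OF bij[OF i]] T i content_in_row_contents by (auto dest: inj_onD)
      qed
    qed
    show "Xi X ` T_inf X = multisegments X"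
    proof (intro equalityI subsetI)
      fix M assume "M \<in> Xi X ` T_inf X"
      then obtain T where T: "T \<in> T_inf X" "M = Xi X T" by blast
      have "set_mset (Xi X T) \<subseteq> (\<Union>i\<in>?I. row_roots X i)"
        using row[OF T(1)] unfolding Xi_content[OF T(1)] by (subst set_mset_sum) blast+
      then show "M \<in> multisegments X"
        unfolding T(2) multisegments_def Union_row_roots by simp
    next
      fix M assume "M \<in> multisegments X"
      then have M: "set_mset M \<subseteq> (\<Union>i\<in>?I. row_roots X i)"
        unfolding multisegments_def Union_row_roots by simp
      have "\<exists>N\<in>row_contents X i. ?box i N = filter_mset (\<lambda>\<alpha>. \<alpha> \<in> row_roots X i) M" if "i \<in> ?I" for i
      proof -
        have "filter_mset (\<lambda>\<alpha>. \<alpha> \<in> row_roots X i) M \<in> ?box i ` row_contents X i"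
          unfolding bij_betw_imp_surj_on[OF bij[OF that]] by auto
        then show ?thesis by (auto simp: image_iff)
      qed
      then obtain N where N: "\<And>i. i \<in> ?I \<Longrightarrow> N i \<in> row_contents X i"
        "\<And>i. i \<in> ?I \<Longrightarrow> ?box i (N i) = filter_mset (\<lambda>\<alpha>. \<alpha> \<in> row_roots X i) M"
        by metis
      from tableau_with_contents[OF N(1)] obtain T
        where T: "T \<in> T_inf X" "\<And>i. i \<in> ?I \<Longrightarrow> content T i = N i" by auto
      have "Xi X T = (\<Sum>i\<in>?I. filter_mset (\<lambda>\<alpha>. \<alpha> \<in> row_roots X i) M)"
        unfolding Xi_content[OF T(1)] by (rule sum.cong) (simp_all only: T(2) N(2))
      also have "\<dots> = filter_mset (\<lambda>\<alpha>. \<alpha> \<in> (\<Union>i\<in>?I. row_roots X i)) M"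
        by (rule sum_filter_mset_disjoint[OF finite_atLeastAtMost row_roots_disjoint])
      also have "\<dots> = M" using M by (auto simp: filter_mset_eq_conv)
      finally show "M \<in> Xi X ` T_inf X" using T(1) by blast
    qed
  qed
qed

lemma Xi_inject: "T \<in> T_inf X \<Longrightarrow> T' \<in> T_inf X \<Longrightarrow> Xi X T = Xi X T' \<longleftrightarrow> T = T'"
  by (rule inj_on_eq_iff[OF bij_betw_imp_inj_on[OF bij_betw_Xi]])

lemma set_mset_Xi: "T \<in> T_inf X \<Longrightarrow> set_mset (Xi X T) \<subseteq> pos_roots X"
  using bij_betw_apply[OF bij_betw_Xi] by (auto simp: multisegments_def)

lemma Xi_surj:
  assumes "set_mset M \<subseteq> pos_roots X"
  shows "\<exists>T\<in>T_inf X. Xi X T = M"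
proof -
  have "M \<in> Xi X ` T_inf X"
    using assms unfolding bij_betw_imp_surj_on[OF bij_betw_Xi] by (simp add: multisegments_def)
  then show ?thesis by blast
qed

lemma finite_pos_roots: "finite (pos_roots X)"
proof -
  have "finite (root_letters X i)" for i by (cases X) auto
  then show ?thesis
    by (simp flip: Union_row_roots add: row_roots_def)
qed

lemma tsize_eq_size_Xi: "T \<in> T_inf X \<Longrightarrow> tsize X T = size (Xi X T)"
  unfolding tsize_def size_multiset_overloaded_eq
  by (rule sum.mono_neutral_right[OF finite_pos_roots set_mset_Xi]) (auto simp: count_eq_zero_iff)

section \<open>Weights and simple roots\<close>

lemma sum_mset_sum: "sum_mset (\<Sum>i\<in>I. f i) = (\<Sum>i\<in>I. sum_mset (f i))"
  by (induction I rule: infinite_finite_induct) auto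

lemma sum_mset_of_sum_list: "sum_mset (\<Sum>x\<leftarrow>xs. f x) = (\<Sum>x\<leftarrow>xs. sum_mset (f x))"
  by (induction xs) auto

lemma sum_mset_box_mseg:
  assumes "i \<in> {1..num_rows X}" "b \<in> row_letters X i"
  shows "sum_mset (box_mseg X i b) = letter_wt X (Pos i) - letter_wt X b"
proof (cases X)
  case TypeG2
  have "{1..3} = {1, 2, 3::nat}" by auto
  then show ?thesis using assms TypeG2 by (auto simp: index_wt_def split: if_splits)
qed (use assms in \<open>auto simp: index_wt_def\<close>)

text \<open>Box by box, the roots contributed add up to the drop in weight.\<close>

lemma wt_eq_sum_mset_Xi:
  assumes "T \<in> T_inf X"
  shows "wt X T = - sum_mset (Xi X T)"
proof -
  have "(\<Sum>b\<leftarrow>trow T i. letter_wt X b - letter_wt X (Pos i)) = - (\<Sum>b\<leftarrow>trow T i. sum_mset (box_mseg X i b))"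
    if i: "i \<in> {1..num_rows X}" for i
  proof -
    have "set (trow T i) \<subseteq> row_letters X i"
      using assms i by (auto simp: T_inf_def is_tableau_def)
    then have "(\<Sum>b\<leftarrow>trow T i. sum_mset (box_mseg X i b)) = (\<Sum>b\<leftarrow>trow T i. - (letter_wt X b - letter_wt X (Pos i)))"
      using sum_mset_box_mseg[OF i] by (intro arg_cong[of _ _ sum_list] map_cong) auto
    then show ?thesis by (simp only: uminus_sum_list_map o_def minus_minus)
  qed
  then show ?thesis
    by (simp add: wt_def Xi_def sum_mset_sum sum_mset_of_sum_list sum_negf)
qed

lemma simple_roots_subset:
  assumes "valid_type X"
  shows "simple_roots X \<subseteq> pos_roots X"
proof (cases X)
  case (TypeA n)
  with assms show ?thesis by (force simp: simple_roots_def)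
next
  case (TypeB n)
  with assms show ?thesis by (force simp: simple_roots_def)
next
  case (TypeC n)
  with assms show ?thesis by (force simp: simple_roots_def)
next
  case (TypeD n)
  have "n - 1 < n" "1 \<le> n - 1" using assms TypeD by auto
  then have "simple_root X i \<in> pos_roots X" if "i \<in> {1..n}" for i
  proof (cases "i = n")
    case True
    then show ?thesis using \<open>n - 1 < n\<close> \<open>1 \<le> n - 1\<close> unfolding TypeD
      by (simp only: simple_root.simps pos_roots.simps simp_thms if_True) blast
  next
    case False
    then have "1 \<le> i" "i < i + 1" "i + 1 \<le> n" using that by auto
    with False show ?thesis unfolding TypeD by (simp only: simple_root.simps pos_roots.simps if_False) blast
  qed
  then show ?thesis unfolding TypeD simple_roots_def lie_rank.simps by blast
qed (auto simp: simple_roots_def)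

lemma simple_root_in: "i \<in> {1..lie_rank X} \<Longrightarrow> simple_root X i \<in> simple_roots X"
  by (simp add: simple_roots_def)

lemma finite_simple_roots: "finite (simple_roots X)"
  by (simp add: simple_roots_def)

text \<open>On differences $\varepsilon_a - \varepsilon_{a+1}$ with \<open>a \<ge> 1\<close> this takes the value 1 if \<open>a = i\<close> and
  vanishes otherwise, like a fundamental coweight.\<close>

definition partial_sum :: "nat \<Rightarrow> weight \<Rightarrow> int" where
  "partial_sum i v = (\<Sum>k = 1..i. Poly_Mapping.lookup v k)"

lemma partial_sum_simps [simp]:
  "partial_sum i (v + w) = partial_sum i v + partial_sum i w"
  "partial_sum i (v - w) = partial_sum i v - partial_sum i w"
  "partial_sum i (eps a) = (if 1 \<le> a \<and> a \<le> i then 1 else 0)"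
  by (simp_all add: partial_sum_def lookup_add lookup_minus sum.distrib sum_subtractf)

lemma partial_sum_double [simp]: "partial_sum i (2 * v) = 2 * partial_sum i v"
proof -
  have "partial_sum i (v + v) = partial_sum i v + partial_sum i v" by (rule partial_sum_simps)
  then show ?thesis by simp
qed

text \<open>Linear independence of the simple roots, as a functional for each of them that vanishes on the others
  (a multiple of the fundamental coweight).\<close>

lemma simple_root_functional:
  assumes "valid_type X" "i \<in> {1..lie_rank X}"
  shows "\<exists>\<phi> :: weight \<Rightarrow> int. (\<forall>v w. \<phi> (v + w) = \<phi> v + \<phi> w) \<and> \<phi> (simple_root X i) \<noteq> 0 \<and>
           (\<forall>k\<in>{1..lie_rank X}. k \<noteq> i \<longrightarrow> \<phi> (simple_root X k) = 0)"
proof (cases X)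
  case (TypeA n)
  with assms show ?thesis by (intro exI[of _ "partial_sum i"]) auto
next
  case (TypeB n)
  with assms show ?thesis by (intro exI[of _ "partial_sum i"]) auto
next
  case (TypeC n)
  with assms show ?thesis by (intro exI[of _ "partial_sum i"]) auto
next
  case (TypeD n)
  show ?thesis
  proof (cases "i = n - 1")
    case True
    \<comment> \<open>\<open>partial_sum (n - 1)\<close> is \<open>1\<close> on both $\alpha_{n-1}$ and $\alpha_n$, whereas \<open>partial_sum n\<close> is \<open>0\<close> on
      $\alpha_{n-1}$ and \<open>2\<close> on $\alpha_n$; this combination cancels $\alpha_n$.\<close>
    with TypeD assms show ?thesis
      by (intro exI[of _ "\<lambda>v. 2 * partial_sum (n - 1) v - partial_sum n v"]) auto
  next
    case False
    with TypeD assms show ?thesis by (intro exI[of _ "partial_sum i"]) auto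
  qed
next
  case TypeG2
  show ?thesis
  proof (cases "i = 1")
    case True
    \<comment> \<open>The coefficient of $\alpha_1$ in terms of the coordinates, by the definition of \<open>g2_root\<close>;
      the third coordinate is the coefficient of $\alpha_2$.\<close>
    with TypeG2 show ?thesis
      by (intro exI[of _ "\<lambda>v. Poly_Mapping.lookup v 1 + 2 * Poly_Mapping.lookup v 3"])
         (auto simp: lookup_add lookup_g2_root)
  next
    case False
    with TypeG2 assms show ?thesis
      by (intro exI[of _ "\<lambda>v. Poly_Mapping.lookup v 3"]) (auto simp: lookup_add lookup_g2_root)
  qed
qed

lemma simple_roots_independent:
  assumes X: "valid_type X"
    and M: "set_mset M \<subseteq> simple_roots X" "set_mset M' \<subseteq> simple_roots X"
    and eq: "sum_mset M = sum_mset M'"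
  shows "M = M'"
proof (rule multiset_eqI)
  fix \<alpha>
  show "count M \<alpha> = count M' \<alpha>"
  proof (cases "\<alpha> \<in> simple_roots X")
    case True
    then obtain i where i: "i \<in> {1..lie_rank X}" "\<alpha> = simple_root X i"
      by (auto simp: simple_roots_def)
    from simple_root_functional[OF X i(1)] obtain \<phi> :: "weight \<Rightarrow> int"
      where \<phi>: "\<And>v w. \<phi> (v + w) = \<phi> v + \<phi> w" "\<phi> \<alpha> \<noteq> 0"
        "\<And>k. k \<in> {1..lie_rank X} \<Longrightarrow> k \<noteq> i \<Longrightarrow> \<phi> (simple_root X k) = 0"
      unfolding i(2) by blast
    have \<phi>_other: "\<phi> \<beta> = 0" if "\<beta> \<in> simple_roots X" "\<beta> \<noteq> \<alpha>" for \<beta>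
      using that \<phi>(3) i(2) unfolding simple_roots_def by blast
    have "\<phi> 0 = 0" using \<phi>(1)[of 0 0] by simp
    then have "\<phi> (sum_mset N) = int (count N \<alpha>) * \<phi> \<alpha>" if "set_mset N \<subseteq> simple_roots X" for N
      using that by (induction N) (auto simp: \<phi>(1) \<phi>_other algebra_simps)
    from this[OF M(1)] this[OF M(2)] eq \<phi>(2) show ?thesis by simp
  next
    case False
    then have "\<alpha> \<notin># M" "\<alpha> \<notin># M'" using M by auto
    then show ?thesis by (simp add: not_in_iff)
  qed
qed

section \<open>Components of the graph\<close>

definition nonsimple_part :: "lie_type \<Rightarrow> tableau \<Rightarrow> weight multiset" where
  "nonsimple_part X T = filter_mset (\<lambda>\<alpha>. \<alpha> \<notin> simple_roots X) (Xi X T)"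

context
  fixes X
  assumes X: "valid_type X"
begin

lemma F_op_eq_iff:
  assumes "T \<in> T_inf X" "T' \<in> T_inf X" "i \<in> {1..lie_rank X}"
  shows "F_op X i T = T' \<longleftrightarrow> Xi X T' = Xi X T + {#simple_root X i#}"
proof -
  have "set_mset (Xi X T + {#simple_root X i#}) \<subseteq> pos_roots X"
    using set_mset_Xi[OF assms(1)] simple_roots_subset[OF X] simple_root_in[OF assms(3)] by auto
  from Xi_surj[OF this] obtain U where U: "U \<in> T_inf X" "Xi X U = Xi X T + {#simple_root X i#}" by blast
  then have "F_op X i T = U"
    unfolding F_op_def by (intro the_equality) (auto simp flip: Xi_inject)
  then show ?thesis using U Xi_inject[of U X T'] assms(2) by auto
qed

lemma E_op_eq_None_iff:
  assumes "T \<in> T_inf X" "i \<in> {1..lie_rank X}"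
  shows "E_op X i T = None \<longleftrightarrow> simple_root X i \<notin># Xi X T"
proof -
  have "(\<exists>T2\<in>T_inf X. F_op X i T2 = T) \<longleftrightarrow> simple_root X i \<in># Xi X T"
  proof
    assume "\<exists>T2\<in>T_inf X. F_op X i T2 = T"
    then show "simple_root X i \<in># Xi X T" using F_op_eq_iff assms by auto
  next
    assume in_Xi: "simple_root X i \<in># Xi X T"
    have "set_mset (Xi X T - {#simple_root X i#}) \<subseteq> pos_roots X"
      using set_mset_Xi[OF assms(1)] by (meson in_diffD subset_iff)
    from Xi_surj[OF this] show "\<exists>T2\<in>T_inf X. F_op X i T2 = T"
      using F_op_eq_iff assms in_Xi by (metis insert_DiffM2)
  qed
  then show ?thesis by (simp add: E_op_def)
qed

lemma sources_iff:
  "T \<in> sources X \<longleftrightarrow> T \<in> T_inf X \<and> nonsimple_part X T = Xi X T"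
proof -
  have "nonsimple_part X T = Xi X T \<longleftrightarrow> (\<forall>i\<in>{1..lie_rank X}. simple_root X i \<notin># Xi X T)"
    unfolding nonsimple_part_def filter_mset_eq_conv simple_roots_def by auto
  then show ?thesis
    using E_op_eq_None_iff[of T] unfolding sources_def by blast
qed

text \<open>Simple roots can be added one at a time, since every intermediate multisegment comes from a tableau.\<close>

lemma edge_path:
  assumes "set_mset M \<subseteq> simple_roots X" "T \<in> T_inf X" "T' \<in> T_inf X" "Xi X T' = Xi X T + M"
  shows "(T, T') \<in> (\<Union>i\<in>{1..lie_rank X}. edges X i)\<^sup>*"
  using assms
proof (induction M arbitrary: T')
  case empty
  then show ?case using Xi_inject by simp
next
  case (add \<alpha> M)
  obtain i where i: "i \<in> {1..lie_rank X}" "\<alpha> = simple_root X i"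
    using add.prems by (auto simp: simple_roots_def)
  have "set_mset (Xi X T + M) \<subseteq> pos_roots X"
    using set_mset_Xi[OF add.prems(2)] simple_roots_subset[OF X] add.prems(1) by auto
  from Xi_surj[OF this] obtain U where U: "U \<in> T_inf X" "Xi X U = Xi X T + M" by blast
  have "(U, T') \<in> edges X i"
    using F_op_eq_iff[OF U(1) add.prems(3) i(1)] U add.prems i by (auto simp: edges_def)
  moreover have "(T, U) \<in> (\<Union>i\<in>{1..lie_rank X}. edges X i)\<^sup>*"
    using add U by auto
  ultimately show ?case using i(1) by (meson UN_I rtrancl.rtrancl_into_rtrancl)
qed

lemma ex_source:
  assumes "T \<in> T_inf X"
  shows "\<exists>S\<in>T_inf X. Xi X S = nonsimple_part X T"
  using set_mset_Xi[OF assms] by (intro Xi_surj) (auto simp: nonsimple_part_def)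

text \<open>Edges change only the multiplicities of simple roots. Conversely, tableaux with the same nonsimple
  part are connected through the tableau of that nonsimple part, from which both are reached by
  directed paths.\<close>

lemma connected_rel_iff:
  "(T, T') \<in> connected_rel X \<longleftrightarrow> T \<in> T_inf X \<and> T' \<in> T_inf X \<and> nonsimple_part X T = nonsimple_part X T'"
proof -
  define E where "E = (\<Union>i\<in>{1..lie_rank X}. edges X i)"
  have rel: "connected_rel X = (E \<union> E\<inverse>)\<^sup>* \<inter> T_inf X \<times> T_inf X"
    by (simp add: connected_rel_def E_def Let_def)
  have step: "nonsimple_part X T = nonsimple_part X T'" if edge: "(T, T') \<in> E" for T T'
  proof -
    obtain i where i: "i \<in> {1..lie_rank X}" "(T, T') \<in> edges X i"
      using edge by (auto simp: E_def)
    then have "Xi X T' = Xi X T + {#simple_root X i#}"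
      using F_op_eq_iff by (auto simp: edges_def)
    then show ?thesis
      using simple_root_in[OF i(1)] by (simp add: nonsimple_part_def)
  qed
  have "nonsimple_part X T = nonsimple_part X T'" if "(T, T') \<in> (E \<union> E\<inverse>)\<^sup>*"
    using that by induction (auto dest: step)
  moreover have "(T, T') \<in> (E \<union> E\<inverse>)\<^sup>*"
    if T: "T \<in> T_inf X" "T' \<in> T_inf X" "nonsimple_part X T = nonsimple_part X T'"
  proof -
    obtain S where S: "S \<in> T_inf X" "Xi X S = nonsimple_part X T" using ex_source T(1) by blast
    have path: "(S, U) \<in> E\<^sup>*" if U: "U \<in> T_inf X" "nonsimple_part X U = nonsimple_part X T" for U
      unfolding E_def
    proof (rule edge_path[OF _ S(1) U(1)])
      let ?M = "filter_mset (\<lambda>\<alpha>. \<alpha> \<in> simple_roots X) (Xi X U)"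
      show "set_mset ?M \<subseteq> simple_roots X" by auto
      have "Xi X S = nonsimple_part X U" by (simp only: S(2) U(2))
      then show "Xi X U = Xi X S + ?M"
        unfolding nonsimple_part_def by (simp only:) (subst add.commute, rule multiset_partition)
    qed
    have "(T, S) \<in> (E\<inverse>)\<^sup>*" using path[of T] T by (simp add: rtrancl_converse)
    moreover have "(S, T') \<in> E\<^sup>*" using path[of T'] T by simp
    ultimately show ?thesis
      by (meson rtrancl_trans in_rtrancl_UnI)
  qed
  ultimately show ?thesis unfolding rel by blast
qed

lemma component_of_source:
  assumes "S \<in> sources X"
  shows "component_of X S = {T \<in> T_inf X. nonsimple_part X T = Xi X S}"
  using assms by (auto simp: component_of_def connected_rel_iff sources_iff)

lemma component_unique_source:
  assumes "C \<in> components X"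
  shows "\<exists>!S. S \<in> C \<and> S \<in> sources X"
proof -
  obtain T where T: "T \<in> T_inf X" "C = connected_rel X `` {T}"
    using assms by (auto simp: components_def quotient_def)
  obtain S where S: "S \<in> T_inf X" "Xi X S = nonsimple_part X T" using ex_source T(1) by blast
  have "nonsimple_part X S = Xi X S"
    unfolding nonsimple_part_def by (simp add: S(2) nonsimple_part_def filter_filter_mset)
  then have "S \<in> C \<and> S \<in> sources X" using S T by (simp add: connected_rel_iff sources_iff)
  moreover have "S' = S" if "S' \<in> C \<and> S' \<in> sources X" for S'
    using that S T by (auto simp: connected_rel_iff sources_iff simp flip: Xi_inject)
  ultimately show ?thesis by blast
qed

text \<open>A component looks like the set of all multisets of simple roots, with its source at the empty
  multiset.\<close>

lemma bij_betw_component: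
  assumes S: "S \<in> sources X"
  shows "bij_betw (\<lambda>T. filter_mset (\<lambda>\<alpha>. \<alpha> \<in> simple_roots X) (Xi X T))
           (component_of X S) {M. set_mset M \<subseteq> simple_roots X}"
    and "T \<in> component_of X S \<Longrightarrow> Xi X T = Xi X S + filter_mset (\<lambda>\<alpha>. \<alpha> \<in> simple_roots X) (Xi X T)"
proof -
  let ?s = "\<lambda>T. filter_mset (\<lambda>\<alpha>. \<alpha> \<in> simple_roots X) (Xi X T)"
  have split: "Xi X T = Xi X S + ?s T" if "T \<in> component_of X S" for T
  proof -
    have "Xi X S = nonsimple_part X T" using that by (simp add: component_of_source[OF S])
    then show ?thesis
      unfolding nonsimple_part_def by (simp only:) (subst add.commute, rule multiset_partition)
  qed
  then show "T \<in> component_of X S \<Longrightarrow> Xi X T = Xi X S + ?s T" .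
  show "bij_betw ?s (component_of X S) {M. set_mset M \<subseteq> simple_roots X}"
  proof (rule bij_betw_imageI)
    show "inj_on ?s (component_of X S)"
    proof (rule inj_onI)
      fix T T' assume T: "T \<in> component_of X S" "T' \<in> component_of X S" "?s T = ?s T'"
      then have "Xi X T = Xi X T'" using split by metis
      then show "T = T'" using T Xi_inject by (auto simp: component_of_source[OF S])
    qed
    show "?s ` component_of X S = {M. set_mset M \<subseteq> simple_roots X}"
    proof (intro equalityI subsetI)
      fix M assume "M \<in> {M. set_mset M \<subseteq> simple_roots X}"
      then have M: "set_mset M \<subseteq> simple_roots X" by simp
      have S': "S \<in> T_inf X" "filter_mset (\<lambda>\<alpha>. \<alpha> \<notin> simple_roots X) (Xi X S) = Xi X S"
        using S by (auto simp: sources_iff nonsimple_part_def)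
      have "set_mset (Xi X S + M) \<subseteq> pos_roots X"
        using set_mset_Xi[OF S'(1)] simple_roots_subset[OF X] M by auto
      from Xi_surj[OF this] obtain T where T: "T \<in> T_inf X" "Xi X T = Xi X S + M" by blast
      have "filter_mset (\<lambda>\<alpha>. \<alpha> \<in> simple_roots X) (Xi X S) = {#}"
        "filter_mset (\<lambda>\<alpha>. \<alpha> \<in> simple_roots X) M = M" "filter_mset (\<lambda>\<alpha>. \<alpha> \<notin> simple_roots X) M = {#}"
        using S'(2) M by (auto simp: filter_mset_eq_conv filter_mset_eq_mempty_iff)
      then have "?s T = M" "T \<in> component_of X S"
        using T S'(2) by (auto simp: component_of_source[OF S] nonsimple_part_def)
      then show "M \<in> ?s ` component_of X S" by blast
    qed auto
  qed
qed

lemma inj_on_wt_component: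
  assumes S: "S \<in> sources X"
  shows "inj_on (wt X) (component_of X S)"
proof (rule inj_onI)
  fix T T' assume T: "T \<in> component_of X S" "T' \<in> component_of X S" "wt X T = wt X T'"
  let ?s = "\<lambda>T. filter_mset (\<lambda>\<alpha>. \<alpha> \<in> simple_roots X) (Xi X T)"
  have "T \<in> T_inf X" "T' \<in> T_inf X" using T by (auto simp: component_of_source[OF S])
  then have "sum_mset (Xi X T) = sum_mset (Xi X T')" using T(3) by (simp add: wt_eq_sum_mset_Xi)
  then have "sum_mset (Xi X S + ?s T) = sum_mset (Xi X S + ?s T')"
    using bij_betw_component(2)[OF S] T(1,2) by metis
  then have "sum_mset (?s T) = sum_mset (?s T')" by simp
  then have "?s T = ?s T'" by (intro simple_roots_independent[OF X]) auto
  then show "T = T'"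
    using bij_betw_imp_inj_on[OF bij_betw_component(1)[OF S]] T by (auto dest: inj_onD)
qed

end

section \<open>Generating series\<close>

unbundle fps_syntax

lemma te_nth: "te k \<mu> $ n = (if n = k then Poly_Mapping.single \<mu> 1 else 0)"
  by (simp add: te_def)

lemma te_mult: "te k \<mu> * te l \<nu> = te (k + l) (\<mu> + \<nu>)"
proof -
  have "te k \<mu> * te l \<nu> = fps_X ^ k * fps_X ^ l *
      (fps_const (Poly_Mapping.single \<mu> 1) * fps_const (Poly_Mapping.single \<nu> 1))"
    by (simp only: te_def ac_simps)
  then show ?thesis by (simp add: te_def mult_single power_add)
qed

text \<open>In the \<open>t\<close>-adic metric, series that agree up to the coefficient \<open>n\<close> have distance less than
  $2^{-n}$.\<close>

lemma has_sum_fpsI: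
  fixes f :: "'a \<Rightarrow> 'b :: ring_1 fps"
  assumes "\<And>n. \<exists>F\<^sub>0. finite F\<^sub>0 \<and> F\<^sub>0 \<subseteq> A \<and>
             (\<forall>F. finite F \<longrightarrow> F\<^sub>0 \<subseteq> F \<longrightarrow> F \<subseteq> A \<longrightarrow> (\<forall>k\<le>n. (\<Sum>x\<in>F. f x) $ k = L $ k))"
  shows "(f has_sum L) A"
  unfolding has_sum_def
proof (rule tendstoI)
  fix e :: real assume "0 < e"
  then obtain n where n: "inverse (2 ^ n) < e"
    using real_arch_pow_inv[of e "1 / 2"] by (auto simp: power_one_over inverse_eq_divide)
  from assms[of n] obtain F\<^sub>0 where F: "finite F\<^sub>0" "F\<^sub>0 \<subseteq> A"
    "\<And>F. finite F \<Longrightarrow> F\<^sub>0 \<subseteq> F \<Longrightarrow> F \<subseteq> A \<Longrightarrow> \<forall>k\<le>n. (\<Sum>x\<in>F. f x) $ k = L $ k" by metis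
  have "dist (\<Sum>x\<in>F. f x) L < e" if "finite F" "F\<^sub>0 \<subseteq> F" "F \<subseteq> A" for F
  proof (cases "(\<Sum>x\<in>F. f x) = L")
    case False
    have "n \<le> subdegree ((\<Sum>x\<in>F. f x) - L)"
      using False F(3)[OF that] by (intro subdegree_geI) auto
    then have "inverse (2 ^ subdegree ((\<Sum>x\<in>F. f x) - L)) \<le> inverse (2 ^ n :: real)"
      by (intro le_imp_inverse_le power_increasing) auto
    then show ?thesis
      using False n unfolding dist_fps_def by (simp only: if_False)
  qed (use \<open>0 < e\<close> in simp)
  then show "\<forall>\<^sub>F F in finite_subsets_at_top A. dist (\<Sum>x\<in>F. f x) L < e"
    unfolding eventually_finite_subsets_at_top using F(1,2) by blast
qed

lemma finite_multisets_of_size: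
  assumes "finite P"
  shows "finite {M. set_mset M \<subseteq> P \<and> size M = n}"
proof -
  have "{M. set_mset M \<subseteq> P \<and> size M = n} = mset ` {xs. set xs \<subseteq> P \<and> length xs = n}"
    by (auto simp: image_iff) (metis ex_mset set_mset_mset size_mset)
  then show ?thesis using finite_lists_length_eq[OF assms] by simp
qed

text \<open>The sum of $t^{|M|} e^{-\sum M}$ over all multisets \<open>M\<close> of elements of \<open>P\<close>, given by its coefficients.\<close>

definition mset_series :: "weight set \<Rightarrow> char_series" where
  "mset_series P = Abs_fps (\<lambda>n. \<Sum>M | set_mset M \<subseteq> P \<and> size M = n. Poly_Mapping.single (- sum_mset M) 1)"

text \<open>Only finitely many multisets over a finite set have size at most \<open>n\<close>, and the others do not affect
  the coefficients up to \<open>n\<close>. The constant factor \<open>c\<close>, later the term of the source, is carried along so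
  that continuity of multiplication need not be established separately.\<close>

lemma has_sum_mset_series:
  assumes "finite P"
  shows "((\<lambda>M. c * te (size M) (- sum_mset M)) has_sum c * mset_series P) {M. set_mset M \<subseteq> P}"
proof (rule has_sum_fpsI)
  fix n
  let ?F = "{M. set_mset M \<subseteq> P \<and> size M \<le> n}"
  have "?F = (\<Union>k\<le>n. {M. set_mset M \<subseteq> P \<and> size M = k})" by auto
  then have "finite ?F" using finite_multisets_of_size[OF assms] by simp
  moreover have "(\<Sum>M\<in>F. c * te (size M) (- sum_mset M)) $ k = (c * mset_series P) $ k"
    if F: "finite F" "?F \<subseteq> F" "F \<subseteq> {M. set_mset M \<subseteq> P}" and "k \<le> n" for F k
  proof -
    have "(\<Sum>M\<in>F. te (size M) (- sum_mset M)) $ l = mset_series P $ l" if "l \<le> n" for l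
    proof -
      have "(\<Sum>M\<in>F. te (size M) (- sum_mset M)) $ l
          = (\<Sum>M\<in>F. if size M = l then Poly_Mapping.single (- sum_mset M) 1 else 0)"
        by (simp add: fps_sum_nth te_nth eq_commute)
      also have "\<dots> = (\<Sum>M\<in>{M \<in> F. size M = l}. Poly_Mapping.single (- sum_mset M) 1)"
        using F(1) by (simp add: sum.inter_filter)
      also have "{M \<in> F. size M = l} = {M. set_mset M \<subseteq> P \<and> size M = l}"
        using F that by auto
      finally show ?thesis by (simp add: mset_series_def)
    qed
    then show ?thesis using \<open>k \<le> n\<close>
      by (simp add: fps_mult_nth flip: sum_distrib_left)
  qed
  ultimately show "\<exists>F\<^sub>0. finite F\<^sub>0 \<and> F\<^sub>0 \<subseteq> {M. set_mset M \<subseteq> P} \<and>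
      (\<forall>F. finite F \<longrightarrow> F\<^sub>0 \<subseteq> F \<longrightarrow> F \<subseteq> {M. set_mset M \<subseteq> P} \<longrightarrow>
        (\<forall>k\<le>n. (\<Sum>M\<in>F. c * te (size M) (- sum_mset M)) $ k = (c * mset_series P) $ k))"
    by (intro exI[of _ ?F]) auto
qed

text \<open>The multisets over \<open>insert \<alpha> P\<close> that contain \<open>\<alpha>\<close> arise from all of them by adding one \<open>\<alpha>\<close>, that is,
  by multiplication with $t e^{-\alpha}$; the others are those over \<open>P\<close>.\<close>

lemma mset_series_insert:
  assumes "finite P" "\<alpha> \<notin> P"
  shows "(1 - te 1 (- \<alpha>)) * mset_series (insert \<alpha> P) = mset_series P"
proof -
  let ?A = "\<lambda>P n. {M :: weight multiset. set_mset M \<subseteq> P \<and> size M = n}"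
  let ?g = "\<lambda>M :: weight multiset. Poly_Mapping.single (- sum_mset M) (1 :: int)"
  have "mset_series (insert \<alpha> P) $ n = mset_series P $ n + (te 1 (- \<alpha>) * mset_series (insert \<alpha> P)) $ n" for n
  proof (cases n)
    case 0
    have "?A P 0 = {{#}}" for P by auto
    then show ?thesis by (simp add: 0 mset_series_def te_nth)
  next
    case (Suc m)
    have "?A (insert \<alpha> P) (Suc m) = ?A P (Suc m) \<union> add_mset \<alpha> ` ?A (insert \<alpha> P) m"
    proof (intro equalityI subsetI)
      fix M assume M: "M \<in> ?A (insert \<alpha> P) (Suc m)"
      show "M \<in> ?A P (Suc m) \<union> add_mset \<alpha> ` ?A (insert \<alpha> P) m"
      proof (cases "\<alpha> \<in># M")
        case True
        then obtain M' where "M = add_mset \<alpha> M'" by (metis insert_DiffM)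
        with M show ?thesis by auto
      qed (use M in auto)
    qed auto
    then have "sum ?g (?A (insert \<alpha> P) (Suc m)) = sum ?g (?A P (Suc m)) + sum ?g (add_mset \<alpha> ` ?A (insert \<alpha> P) m)"
      using assms by (simp only:) (rule sum.union_disjoint; auto intro: finite_multisets_of_size)
    also have "sum ?g (add_mset \<alpha> ` ?A (insert \<alpha> P) m) = Poly_Mapping.single (- \<alpha>) 1 * sum ?g (?A (insert \<alpha> P) m)"
      by (subst sum.reindex) (auto simp: inj_on_def sum_distrib_left mult_single algebra_simps)
    also have "\<dots> = (te 1 (- \<alpha>) * mset_series (insert \<alpha> P)) $ Suc m"
      by (simp add: te_def mult.assoc mset_series_def)
    finally show ?thesis by (simp add: Suc mset_series_def)
  qed
  then show ?thesis by (simp add: fps_eq_iff left_diff_distrib)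
qed

lemma prod_mult_mset_series:
  assumes "finite P"
  shows "(\<Prod>\<alpha>\<in>P. 1 - te 1 (- \<alpha>)) * mset_series P = 1"
  using assms
proof (induction P rule: finite_induct)
  case empty
  have "{M :: weight multiset. M = {#} \<and> size M = n} = (if n = 0 then {{#}} else {})" for n by auto
  then show ?case by (auto simp: mset_series_def fps_eq_iff)
next
  case (insert \<alpha> P)
  have "(\<Prod>\<alpha>\<in>insert \<alpha> P. 1 - te 1 (- \<alpha>)) * mset_series (insert \<alpha> P)
      = (\<Prod>\<alpha>\<in>P. 1 - te 1 (- \<alpha>)) * ((1 - te 1 (- \<alpha>)) * mset_series (insert \<alpha> P))"
    by (simp only: prod.insert[OF insert.hyps] ac_simps)
  then show ?case by (simp only: mset_series_insert[OF insert.hyps] insert.IH)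
qed

text \<open>By \<open>prod_mult_mset_series\<close> the series is an inverse of the product, and inverses are unique.\<close>

lemma series_quot_prod:
  assumes "finite P"
  shows "series_quot f (\<Prod>\<alpha>\<in>P. 1 - te 1 (- \<alpha>)) = f * mset_series P"
proof -
  let ?g = "\<Prod>\<alpha>\<in>P. 1 - te 1 (- \<alpha>)"
  have "?g $ 0 = 1"
    using assms by (induction P rule: finite_induct) (simp_all add: te_nth)
  then have "?g * fps_right_inverse ?g 1 = 1"
    by (intro fps_right_inverse) simp
  then have "mset_series P = mset_series P * (?g * fps_right_inverse ?g 1)" by simp
  also have "\<dots> = (?g * mset_series P) * fps_right_inverse ?g 1" by (simp only: ac_simps)
  also have "\<dots> = fps_right_inverse ?g 1" by (simp only: prod_mult_mset_series[OF assms] mult_1_left)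
  finally have "fps_right_inverse ?g 1 = mset_series P" ..
  then show ?thesis by (simp add: series_quot_def)
qed

text \<open>The term of \<open>T\<close> is the term of the source times the term of the multiset of simple roots of \<open>T\<close>, and
  these multisets run through all multisets of simple roots once.\<close>

lemma component_series:
  assumes X: "valid_type X" and S: "S \<in> sources X"
  shows "((\<lambda>T. te (tsize X T) (wt X T)) has_sum
      series_quot (te (tsize X S) (wt X S)) (\<Prod>\<alpha>\<in>simple_roots X. 1 - te 1 (- \<alpha>))) (component_of X S)"
proof -
  let ?c = "te (tsize X S) (wt X S)"
  let ?s = "\<lambda>T. filter_mset (\<lambda>\<alpha>. \<alpha> \<in> simple_roots X) (Xi X T)"
  have S_inf: "S \<in> T_inf X" using S by (simp add: sources_iff[OF X])
  have summand: "te (tsize X T) (wt X T) = ?c * te (size (?s T)) (- sum_mset (?s T))"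
    if T: "T \<in> component_of X S" for T
  proof -
    have T_inf: "T \<in> T_inf X" using T by (simp add: component_of_source[OF X S])
    have split: "Xi X T = Xi X S + ?s T" by (rule bij_betw_component(2)[OF X S T])
    have "size (Xi X T) = size (Xi X S) + size (?s T)" by (subst split) (rule size_union)
    moreover have "sum_mset (Xi X T) = sum_mset (Xi X S) + sum_mset (?s T)"
      by (subst split) (rule sum_mset.union)
    ultimately show ?thesis
      by (simp add: te_mult tsize_eq_size_Xi wt_eq_sum_mset_Xi T_inf S_inf)
  qed
  have "((\<lambda>M. ?c * te (size M) (- sum_mset M)) has_sum ?c * mset_series (simple_roots X))
      {M. set_mset M \<subseteq> simple_roots X}"
    by (rule has_sum_mset_series[OF finite_simple_roots])
  then have "((\<lambda>T. ?c * te (size (?s T)) (- sum_mset (?s T))) has_sum ?c * mset_series (simple_roots X))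
      (component_of X S)"
    by (subst has_sum_reindex_bij_betw[OF bij_betw_component(1)[OF X S],
          of "\<lambda>M. ?c * te (size M) (- sum_mset M)"])
  then show ?thesis
    unfolding series_quot_prod[OF finite_simple_roots] by (simp only: summand cong: has_sum_cong)
qed

theorem theorem3p3:
  fixes X :: lie_type
  assumes "valid_type X"
  shows
    "(\<forall>T\<in>T_inf X.
        (T \<in> sources X \<longleftrightarrow> (\<forall>i\<in>{1..lie_rank X}. count (Xi X T) (simple_root X i) = 0)) \<and>
        (T \<in> sources X \<longleftrightarrow>
           Xi X T = (\<Sum>\<alpha>\<in>pos_roots X - simple_roots X. replicate_mset (count (Xi X T) \<alpha>) \<alpha>)))
     \<and> (\<forall>C\<in>components X. \<exists>!S. S \<in> C \<and> S \<in> sources X)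
     \<and> (\<forall>S\<in>sources X.
          inj_on (wt X) (component_of X S) \<and>
          ((\<lambda>T. te (tsize X T) (wt X T)) has_sum
             series_quot (te (tsize X S) (wt X S)) (\<Prod>\<alpha>\<in>simple_roots X. 1 - te 1 (- \<alpha>)))
            (component_of X S))"
proof (intro conjI ballI)
  note X = assms
  fix T assume T: "T \<in> T_inf X"
  show "T \<in> sources X \<longleftrightarrow> (\<forall>i\<in>{1..lie_rank X}. count (Xi X T) (simple_root X i) = 0)"
    using E_op_eq_None_iff[OF X T] T by (auto simp: sources_def count_eq_zero_iff)
  have "(\<Sum>\<alpha>\<in>pos_roots X - simple_roots X. replicate_mset (count (Xi X T) \<alpha>) \<alpha>) = nonsimple_part X T"
  proof (rule multiset_eqI)
    fix \<beta>
    have "count (\<Sum>\<alpha>\<in>pos_roots X - simple_roots X. replicate_mset (count (Xi X T) \<alpha>) \<alpha>) \<beta>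
        = (\<Sum>\<alpha>\<in>pos_roots X - simple_roots X. if \<alpha> = \<beta> then count (Xi X T) \<beta> else 0)"
      unfolding count_sum by (rule sum.cong) auto
    also have "\<dots> = (if \<beta> \<in> pos_roots X - simple_roots X then count (Xi X T) \<beta> else 0)"
      using finite_pos_roots by (subst sum.delta) auto
    also have "\<dots> = count (nonsimple_part X T) \<beta>"
      using set_mset_Xi[OF T] by (auto simp: nonsimple_part_def not_in_iff[symmetric])
    finally show "count (\<Sum>\<alpha>\<in>pos_roots X - simple_roots X. replicate_mset (count (Xi X T) \<alpha>) \<alpha>) \<beta>
        = count (nonsimple_part X T) \<beta>" .
  qed
  then show "T \<in> sources X \<longleftrightarrow>
      Xi X T = (\<Sum>\<alpha>\<in>pos_roots X - simple_roots X. replicate_mset (count (Xi X T) \<alpha>) \<alpha>)"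
    using T by (auto simp: sources_iff[OF X])
next
  fix C assume "C \<in> components X"
  then show "\<exists>!S. S \<in> C \<and> S \<in> sources X" by (rule component_unique_source[OF assms])
next
  fix S assume S: "S \<in> sources X"
  then show "inj_on (wt X) (component_of X S)" by (rule inj_on_wt_component[OF assms])
  show "((\<lambda>T. te (tsize X T) (wt X T)) has_sum
      series_quot (te (tsize X S) (wt X S)) (\<Prod>\<alpha>\<in>simple_roots X. 1 - te 1 (- \<alpha>))) (component_of X S)"
    by (rule component_series[OF assms S])
qed

end
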